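(* Let $M\ge 1$ and $n_a,n_q\ge 0$ be integers, and set $N_a=Mn_a$, $N_q=Mn_q$. Let ${\boldsymbol\theta}\sim\mathcal{CN}(\mathbf 0,\mathbf I_M)$ be a zero-mean circularly symmetric complex Gaussian random vector in $\mathbb C^M$. Let $\mathbf H\in\mathbb C^{N_a\times M}$ be the matrix obtained by stacking vertically $n_a$ blocks $\mathbf H_1,\dots,\mathbf H_{n_a}\in\mathbb C^{M\times M}$, where each block satisfies $\mathbf H_i^H\mathbf H_i=\rho_a\mathbf I_M$ for some $\rho_a>0$ (the products $\mathbf H_i^H\mathbf H_j$, $i\ne j$, are arbitrary). Let $\mathbf G=\mathbf 1_{n_q}\otimes\mathbf G_1\in\mathbb C^{N_q\times M}$, where $\mathbf G_1\in\mathbb C^{M\times M}$ satisfies $\mathbf G_1^H\mathbf G_1=\rho_q\mathbf I_M$ for some $\rho_q>0$. Observe $$\mathbf x_a=\mathbf H{\boldsymbol\theta}+\mathbf w_a,\qquad \mathbf x_q=\mathcal Q(\mathbf G{\boldsymbol\theta}+\mathbf w_q),\qquad \mathbf x=[\mathbf x_a^T\ \mathbf x_q^T]^T,$$ where $\mathbf w_a\sim\mathcal{CN}(\mathbf 0,\sigma_a^2\mathbf I_{N_a})$, $\mathbf w_q\sim\mathcal{CN}(\mathbf 0,\sigma_q^2\mathbf I_{N_q})$ with $\sigma_a^2,\sigma_q^2>0$, and ${\boldsymbol\theta},\mathbf w_a,\mathbf w_q$ are mutually independent. Define $$\alpha=1-\frac{2}{\pi}\arcsin\!\Big(\frac{\rho_q}{\rho_q+\sigma_q^2}\Big)=\frac{2}{\pi}\arccos\!\Big(\frac{\rho_q}{\rho_q+\sigma_q^2}\Big),\qquad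 \beta(n_a)=\frac{2}{\pi}\arcsin\!\Big(\frac{\rho_q}{\rho_q+\sigma_q^2}\Big)\frac{1}{\rho_q}-\frac{2\rho_a n_a}{\pi(\rho_q+\sigma_q^2)(\rho_a n_a+\sigma_a^2)}.$$ Then the LMMSE estimator of ${\boldsymbol\theta}$ based on $\mathbf x$ is $$\hat{\boldsymbol\theta}=\Big(\frac{1}{\rho_a n_a+\sigma_a^2}-\frac{2\rho_q n_q\sigma_a^2}{\pi(\rho_q+\sigma_q^2)(\alpha+\beta(n_a)\rho_q n_q)(\rho_a n_a+\sigma_a^2)^2}\Big)\mathbf H^H\mathbf x_a+\sqrt{\frac{2}{\pi(\rho_q+\sigma_q^2)}}\,\frac{\sigma_a^2}{(\alpha+\beta(n_a)\rho_q n_q)(\rho_a n_a+\sigma_a^2)}\,\mathbf G^H\mathbf x_q,$$ and its mean-squared error $\mathrm{E}[(\hat{\boldsymbol\theta}-{\boldsymbol\theta})^H(\hat{\boldsymbol\theta}-{\boldsymbol\theta})]$ equals $$M-M\Big(\frac{\rho_a n_a}{\rho_a n_a+\sigma_a^2}+\frac{2\rho_q n_q\sigma_a^4}{\pi(\rho_q+\sigma_q^2)(\alpha+\beta(n_a)\rho_q n_q)(\rho_a n_a+\sigma_a^2)^2}\Big).$$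
   Context: $\mathcal{CN}(\boldsymbol\mu,\boldsymbol\Sigma)$ denotes the circularly symmetric complex Gaussian distribution. $\mathbf 1_{n}$ is the all-ones vector of length $n$, $\otimes$ the Kronecker product, $(\cdot)^H$ conjugate transpose. When $n_a=0$ (resp. $n_q=0$) the analog (resp. quantized) part of the observation is absent. The 1-bit quantizer $\mathcal Q$ acts elementwise on complex numbers by $\mathcal Q(z)=\frac{1}{\sqrt2}\big(\mathrm{sgn}(\mathrm{Re}\,z)+j\,\mathrm{sgn}(\mathrm{Im}\,z)\big)$, where $\mathrm{sgn}(t)=1$ for $t\ge0$ and $-1$ for $t<0$. For a zero-mean observation vector $\mathbf x$ with nonsingular covariance $\mathbf C_{\mathbf x}=\mathrm E[\mathbf x\mathbf x^H]$ and cross-covariance $\mathbf C_{\boldsymbol\theta\mathbf x}=\mathrm E[\boldsymbol\theta\mathbf x^H]$, the LMMSE estimator is $\hat{\boldsymbol\theta}=\mathbf C_{\boldsymbol\theta\mathbf x}\mathbf C_{\mathbf x}^{-1}\mathbf x$. *)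

theory Defs
  imports "HOL-Probability.Probability" "Jordan_Normal_Form.Schur_Decomposition"
    "Jordan_Normal_Form.Gauss_Jordan_Elimination"
begin

definition sgn1 :: "real \<Rightarrow> real" where
  "sgn1 t = (if t \<ge> 0 then 1 else -1)"

definition quant :: "complex \<Rightarrow> complex" where
  "quant z = (complex_of_real (sgn1 (Re z)) + \<i> * complex_of_real (sgn1 (Im z))) / complex_of_real (sqrt 2)"

definition quant_vec :: "complex vec \<Rightarrow> complex vec" where
  "quant_vec v = map_vec quant v"

definition stack_blocks :: "nat \<Rightarrow> nat \<Rightarrow> (nat \<Rightarrow> complex mat) \<Rightarrow> complex mat" where
  "stack_blocks m n B = mat (m * n) m (\<lambda>(r, c). B (r div m) $$ (r mod m, c))"

definition kron_ones :: "nat \<Rightarrow> nat \<Rightarrow> complex mat \<Rightarrow> complex mat" where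
  "kron_ones m n G1 = mat (m * n) m (\<lambda>(r, c). G1 $$ (r mod m, c))"

definition vstack :: "complex vec \<Rightarrow> complex vec \<Rightarrow> complex vec" where
  "vstack a b = vec (dim_vec a + dim_vec b)
      (\<lambda>i. if i < dim_vec a then a $ i else b $ (i - dim_vec a))"

definition rvec :: "nat \<Rightarrow> ('w \<Rightarrow> nat \<Rightarrow> complex) \<Rightarrow> 'w \<Rightarrow> complex vec" where
  "rvec n Z \<omega> = vec n (Z \<omega>)"

definition cross_cov :: "'w measure \<Rightarrow> nat \<Rightarrow> nat \<Rightarrow> ('w \<Rightarrow> complex vec) \<Rightarrow> ('w \<Rightarrow> complex vec) \<Rightarrow> complex mat" where
  "cross_cov P n k X Y = mat n k (\<lambda>(i, j). integral\<^sup>L P (\<lambda>\<omega>. X \<omega> $ i * cnj (Y \<omega> $ j)))"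

(* LMMSE estimator  C_{theta x} C_x^{-1} x  (C_x assumed nonsingular) *)
definition lmmse :: "'w measure \<Rightarrow> nat \<Rightarrow> nat \<Rightarrow> ('w \<Rightarrow> complex vec) \<Rightarrow> ('w \<Rightarrow> complex vec) \<Rightarrow> 'w \<Rightarrow> complex vec" where
  "lmmse P m n \<theta> x \<omega> =
     (cross_cov P m n \<theta> x * the (mat_inverse (cross_cov P n n x x))) *\<^sub>v x \<omega>"

definition scalar_comps :: "('w \<Rightarrow> nat \<Rightarrow> complex) \<Rightarrow> ('w \<Rightarrow> nat \<Rightarrow> complex) \<Rightarrow> ('w \<Rightarrow> nat \<Rightarrow> complex)
    \<Rightarrow> nat \<times> bool \<times> nat \<Rightarrow> 'w \<Rightarrow> real" where
  "scalar_comps th wa wq = (\<lambda>(k, b, i) \<omega>.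
     (let z = (if k = 0 then th \<omega> i else if k = 1 then wa \<omega> i else wq \<omega> i)
      in if b then Re z else Im z))"

definition comp_index :: "nat \<Rightarrow> nat \<Rightarrow> nat \<Rightarrow> (nat \<times> bool \<times> nat) set" where
  "comp_index m Na Nq = {(k, b, i). (k = 0 \<and> i < m) \<or> (k = 1 \<and> i < Na) \<or> (k = 2 \<and> i < Nq)}"

(* variance of each complex entry in block k *)
definition block_var :: "real \<Rightarrow> real \<Rightarrow> nat \<Rightarrow> real" where
  "block_var sa2 sq2 k = (if k = 0 then 1 else if k = 1 then sa2 else sq2)"

definition alpha_c :: "real \<Rightarrow> real \<Rightarrow> real" where
  "alpha_c \<rho>q sq2 = 1 - 2 / pi * arcsin (\<rho>q / (\<rho>q + sq2))"

definition beta_c :: "real \<Rightarrow> real \<Rightarrow> real \<Rightarrow> real \<Rightarrow> nat \<Rightarrow> real" where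
  "beta_c \<rho>a \<rho>q sa2 sq2 na = 2 / pi * arcsin (\<rho>q / (\<rho>q + sq2)) * (1 / \<rho>q)
      - 2 * \<rho>a * real na / (pi * (\<rho>q + sq2) * (\<rho>a * real na + sa2))"

end

theory Submission
  imports Defs
begin

text \<open>All scalar variables in play are real parts of complex linear combinations of one circular
  Gaussian family, so pairs of them are described by their joint characteristic function. Uncorrelated
  pairs are independent; hence a pair is linear regression plus independent noise, which gives
  Bussgang's formula \<open>E [X sgn Y] = sqrt (2 / (\<pi> Var Y)) Cov (X, Y)\<close> and, through the Cauchy law of
  a Gaussian ratio, the arcsine law for \<open>E [sgn X sgn Y]\<close>. With
  \<open>\<kappa> = sqrt (2 / (\<pi> (\<rho>\<^sub>q + \<sigma>\<^sub>q\<^sup>2)))\<close> and \<open>\<gamma> = 2 / \<pi> arcsin (\<rho>\<^sub>q / (\<rho>\<^sub>q + \<sigma>\<^sub>q\<^sup>2)) / \<rho>\<^sub>q\<close> the covariance of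
  the observation therefore has the blocks \<open>H H\<^sup>H + \<sigma>\<^sub>a\<^sup>2 I\<close>, \<open>\<kappa> H G\<^sup>H\<close>, \<open>\<kappa> G H\<^sup>H\<close>, \<open>\<alpha> I + \<gamma> G G\<^sup>H\<close>;
  since \<open>H\<^sup>H H\<close> and \<open>G\<^sup>H G\<close> are scalar, inverting it reduces to a \<open>2 \<times> 2\<close> scalar system.\<close>

section \<open>Gaussian pairs\<close>

text \<open>The obstacle is that the arcsine law acts entrywise, and an entrywise nonlinear function
  of a covariance matrix normally destroys its algebra. Here it survives: the rows of the scaled
  unitary \<open>G1\<close> are orthogonal, so the normalised covariances of the signal before
  quantization are only 1 (same entry), \<open>r = \<rho>q / (\<rho>q + sq2)\<close> (rows equal mod
  \<open>M\<close>) and 0. Two coefficients can match three values because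
  \<open>arcsin 0 = 0\<close>: \<gamma> fits the off-diagonal value
  \<open>2 / pi * arcsin r\<close>, and \<open>\<alpha> = 1 - \<gamma> * \<rho>q\<close> repairs the
  diagonal, where a quantized entry has second moment 1. Nonsingularity comes from
  \<open>x \<le> arcsin x\<close>, which gives \<open>\<kappa>\<^sup>2 \<le> \<gamma>\<close> and
  keeps the scalar determinant positive. No formula for the inverse is ever written: a trivial
  kernel provides some inverse, and the closed-form gain matrix is recognised because it satisfies
  the normal equations, which also yield the error through orthogonality.\<close>

lemma (in prob_space) weighted_char_factor:
  fixes X g :: "'a \<Rightarrow> real"
  assumes [measurable]: "X \<in> borel_measurable M" "g \<in> borel_measurable M"
    and g: "\<And>w. 0 \<le> g w" "\<And>w. g w \<le> B"
    and eq: "\<And>s. (CLINT w|M. complex_of_real (g w) * iexp (s * X w)) = complex_of_real (LINT w|M. g w) * (CLINT w|M. iexp (s * X w))"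
    and A: "A \<in> sets borel"
  shows "(LINT w|M. g w * indicator A (X w)) = (LINT w|M. g w) * (LINT w|M. indicator A (X w))"
proof -
  note A[measurable]
  have ig: "integrable M g" using g by (intro integrable_const_bound[where B=B]) auto
  define m where "m = (LINT w|M. g w)"
  have m0: "m \<ge> 0" unfolding m_def using g by simp
  show ?thesis
  proof (cases "m = 0")
    case True
    have "AE w in M. g w = 0"
      using integral_nonneg_eq_0_iff_AE[OF ig] g True m_def by auto
    then have "(LINT w|M. g w * indicator A (X w)) = (LINT w|M. 0)"
      by (intro integral_cong_AE) auto
    then show ?thesis using True m_def by simp
  next
    case False
    with m0 have m: "m > 0" by simp
    \<comment> \<open>Normalised by its mean, \<open>g\<close> becomes a probability density. The
      hypothesis \<open>eq\<close> then says that \<open>X\<close> has the same characteristic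
      function under \<open>Q\<close> as under \<open>M\<close>, hence the same law. A weight of
      mean 0 cannot be normalised, but it vanishes almost everywhere.\<close>
    define Q where "Q = density M (\<lambda>w. ennreal (g w / m))"
    have sQ[simp]: "sets Q = sets M" "space Q = space M" by (auto simp: Q_def)
    have "emeasure Q (space Q) = (\<integral>\<^sup>+ w. ennreal (g w / m) \<partial>M)"
      unfolding Q_def by (auto simp: emeasure_density intro!: nn_integral_cong)
    also have "\<dots> = ennreal (LINT w|M. g w / m)"
      using ig g m by (intro nn_integral_eq_integral) auto
    also have "(LINT w|M. g w / m) = 1" using m by (simp add: m_def)
    finally interpret Q: prob_space Q by (intro prob_spaceI) simp
    have XQ[measurable]: "X \<in> borel_measurable Q" unfolding Q_def by simp
    have rd1: "real_distribution (distr Q borel X)" by (rule Q.real_distribution_distr) simp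
    have rd2: "real_distribution (distr M borel X)" by (rule real_distribution_distr) simp
    have "char (distr Q borel X) s = char (distr M borel X) s" for s
    proof -
      have "char (distr Q borel X) s = (CLINT w|Q. iexp (s * X w))"
        by (simp add: char_def integral_distr)
      also have "\<dots> = (CLINT w|M. (g w / m) *\<^sub>R iexp (s * X w))"
        unfolding Q_def using m g by (subst integral_density) auto
      also have "\<dots> = (CLINT w|M. (1 / complex_of_real m) * (complex_of_real (g w) * iexp (s * X w)))"
        by (simp add: scaleR_conv_of_real)
      also have "\<dots> = (1 / complex_of_real m) * (complex_of_real m * (CLINT w|M. iexp (s * X w)))"
        by (subst integral_mult_right_zero, subst eq) (simp add: m_def)
      also have "\<dots> = char (distr M borel X) s" using m by (simp add: char_def integral_distr)
      finally show ?thesis .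
    qed
    then have "distr Q borel X = distr M borel X"
      using Levy_uniqueness[OF rd1 rd2] by auto
    then have "(LINT x|distr Q borel X. indicator A x :: real) = (LINT x|distr M borel X. indicator A x)"
      by simp
    then have "(LINT w|Q. indicator A (X w) :: real) = (LINT w|M. indicator A (X w))"
      by (subst (asm) (1 2) integral_distr) auto
    moreover have "(LINT w|Q. indicator A (X w) :: real) = (LINT w|M. (g w / m) *\<^sub>R indicator A (X w))"
      unfolding Q_def using m g by (subst integral_density) auto
    moreover have "\<dots> = (LINT w|M. g w * indicator A (X w)) / m" by simp
    ultimately show ?thesis using m by (simp add: m_def field_simps)
  qed
qed

text \<open>\<open>u\<close>, \<open>v\<close> are the variances and \<open>c\<close> is the covariance; degenerate pairs are allowed.\<close>

definition gauss_pair :: "'w measure \<Rightarrow> ('w \<Rightarrow> real) \<Rightarrow> ('w \<Rightarrow> real) \<Rightarrow> real \<Rightarrow> real \<Rightarrow> real \<Rightarrow> bool" where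
  "gauss_pair M X Y u v c \<longleftrightarrow> X \<in> borel_measurable M \<and> Y \<in> borel_measurable M \<and>
     (\<forall>a b. (CLINT w|M. iexp (a * X w + b * Y w)) =
        complex_of_real (exp (- (a\<^sup>2 * u + 2 * a * b * c + b\<^sup>2 * v) / 2)))"

lemma gauss_pair_measurable:
  assumes "gauss_pair M X Y u v c"
  shows "X \<in> borel_measurable M" "Y \<in> borel_measurable M"
  using assms by (auto simp: gauss_pair_def)

lemma gauss_pair_char:
  assumes "gauss_pair M X Y u v c"
  shows "(CLINT w|M. iexp (a * X w + b * Y w)) =
     complex_of_real (exp (- (a\<^sup>2 * u + 2 * a * b * c + b\<^sup>2 * v) / 2))"
  using assms by (simp add: gauss_pair_def)

text \<open>Swapping the two variables, splitting off a regression residual and whitening a pair are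
  all instances of this.\<close>

lemma gauss_pair_linear:
  assumes G: "gauss_pair M X Y u v c"
  shows "gauss_pair M (\<lambda>w. p * X w + q * Y w) (\<lambda>w. r * X w + s * Y w)
     (p\<^sup>2 * u + 2 * p * q * c + q\<^sup>2 * v) (r\<^sup>2 * u + 2 * r * s * c + s\<^sup>2 * v)
     (p * r * u + (p * s + q * r) * c + q * s * v)"
proof -
  note [measurable] = gauss_pair_measurable[OF G]
  have "(CLINT w|M. iexp (a * (p * X w + q * Y w) + b * (r * X w + s * Y w))) =
     complex_of_real (exp (- (a\<^sup>2 * (p\<^sup>2 * u + 2 * p * q * c + q\<^sup>2 * v) + 2 * a * b * (p * r * u + (p * s + q * r) * c + q * s * v)
       + b\<^sup>2 * (r\<^sup>2 * u + 2 * r * s * c + s\<^sup>2 * v)) / 2))" for a b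
  proof -
    have "a * (p * X w + q * Y w) + b * (r * X w + s * Y w) = (a * p + b * r) * X w + (a * q + b * s) * Y w" for w
      by (simp add: algebra_simps)
    then show ?thesis
      by (simp only: gauss_pair_char[OF G]) (simp add: algebra_simps power2_eq_square)
  qed
  then show ?thesis unfolding gauss_pair_def by simp
qed

lemma (in prob_space) integrable_iexp_real:
  "X \<in> borel_measurable M \<Longrightarrow> integrable M (\<lambda>w. iexp (X w))"
  by (intro integrable_const_bound[of _ 1]) auto

text \<open>Both weights \<open>1 + cos (t Y)\<close> and \<open>1 + sin (t Y)\<close> are nonnegative, so the one-dimensional
  uniqueness theorem can be applied to \<open>X\<close> under the reweighted measures; this replaces a
  two-dimensional uniqueness theorem.\<close>

lemma (in prob_space) gauss_pair_indep_char:
  assumes G: "gauss_pair M X Y u v 0" and A: "A \<in> sets borel"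
  shows "(CLINT w|M. complex_of_real (indicator A (X w)) * iexp (t * Y w)) =
     complex_of_real (LINT w|M. indicator A (X w)) * (CLINT w|M. iexp (t * Y w))"
proof -
  note [measurable] = gauss_pair_measurable[OF G] A
  let ?e = "exp (- (t\<^sup>2 * v) / 2)"
  have ch: "(CLINT w|M. iexp (a * X w + b * Y w)) = complex_of_real (exp (- (a\<^sup>2 * u) / 2)) * complex_of_real (exp (- (b\<^sup>2 * v) / 2))" for a b
    unfolding gauss_pair_char[OF G] by (simp flip: exp_add of_real_mult add: field_simps)
  have int: "integrable M (\<lambda>w. iexp (a * X w + b * Y w))" for a b
    by (rule integrable_iexp_real) simp
  have int1: "integrable M (\<lambda>w. iexp (a * X w))" for a
    by (rule integrable_iexp_real) simp
  have chX: "(CLINT w|M. iexp (a * X w)) = complex_of_real (exp (- (a\<^sup>2 * u) / 2))" for a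
    using ch[of a 0] by simp
  have chY: "(CLINT w|M. iexp (b * Y w)) = complex_of_real (exp (- (b\<^sup>2 * v) / 2))" for b
    using ch[of 0 b] by simp
  \<comment> \<open>Euler's formulas turn the trigonometric weights into joint characteristic
    functions at \<open>(s, t)\<close> and \<open>(s, -t)\<close>. With covariance 0 these two
    values agree, so the cosine contributes the factor \<open>?e\<close> while the sine
    cancels.\<close>
  have cosE: "complex_of_real (1 + cos (t * y)) * iexp (s * x) =
     iexp (s * x) + (1/2) * (iexp (s * x + t * y) + iexp (s * x + (-t) * y))" for s x y
    by (simp add: cos_of_real[symmetric] cos_exp_eq exp_add[symmetric] algebra_simps del: cos_of_real)
  have sinE: "complex_of_real (1 + sin (t * y)) * iexp (s * x) =
     iexp (s * x) + (-\<i>/2) * (iexp (s * x + t * y) - iexp (s * x + (-t) * y))" for s x y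
    by (simp add: sin_of_real[symmetric] sin_exp_eq exp_add[symmetric] field_simps del: sin_of_real)
  have c1: "(CLINT w|M. complex_of_real (1 + cos (t * Y w)) * iexp (s * X w)) =
       complex_of_real (1 + ?e) * complex_of_real (exp (- (s\<^sup>2 * u) / 2))" for s
    unfolding cosE using int int1
    by (simp only: Bochner_Integration.integral_add integrable_mult_right Bochner_Integration.integrable_add integral_mult_right_zero ch chX)
      (simp add: algebra_simps)
  have s1: "(CLINT w|M. complex_of_real (1 + sin (t * Y w)) * iexp (s * X w)) =
       complex_of_real (exp (- (s\<^sup>2 * u) / 2))" for s
    unfolding sinE using int int1
    by (simp only: Bochner_Integration.integral_add Bochner_Integration.integral_diff integrable_mult_right Bochner_Integration.integrable_diff integral_mult_right_zero ch chX)
      (simp add: algebra_simps)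
  \<comment> \<open>At \<open>s = 0\<close> the weighted characteristic function is the mean of the
    weight, which is the normalising factor that \<open>weighted_char_factor\<close> asks
    for.\<close>
  have c0: "(LINT w|M. 1 + cos (t * Y w)) = 1 + ?e"
    using c1[of 0] by (simp add: integral_complex_of_real flip: of_real_add)
  have s0: "(LINT w|M. 1 + sin (t * Y w)) = 1"
    using s1[of 0] by (simp add: integral_complex_of_real flip: of_real_add)
  let ?p = "LINT w|M. indicator A (X w) :: real"
  have bnd: "0 \<le> 1 + cos x" "1 + cos x \<le> 2" "0 \<le> 1 + sin x" "1 + sin x \<le> 2" for x :: real
    using cos_ge_minus_one[of x] cos_le_one[of x] sin_ge_minus_one[of x] sin_le_one[of x] by linarith+
  have cA: "(LINT w|M. (1 + cos (t * Y w)) * indicator A (X w)) = (1 + ?e) * ?p"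
    using weighted_char_factor[of X "\<lambda>w. 1 + cos (t * Y w)" 2 A] bnd A c0 c1 chX by simp
  have sA: "(LINT w|M. (1 + sin (t * Y w)) * indicator A (X w)) = ?p"
    using weighted_char_factor[of X "\<lambda>w. 1 + sin (t * Y w)" 2 A] bnd A s0 s1 chX by simp
  have iA: "integrable M (\<lambda>w. indicator A (X w) :: real)"
    by (intro integrable_const_bound[where B=1]) auto
  have ic: "integrable M (\<lambda>w. cos (t * Y w) * indicator A (X w))"
    by (intro integrable_const_bound[where B=1]) (auto simp: indicator_def)
  have isn: "integrable M (\<lambda>w. sin (t * Y w) * indicator A (X w))"
    by (intro integrable_const_bound[where B=1]) (auto simp: indicator_def)
  have cA': "(LINT w|M. cos (t * Y w) * indicator A (X w)) = ?e * ?p"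
    using cA iA ic by (simp add: distrib_right)
  have sA': "(LINT w|M. sin (t * Y w) * indicator A (X w)) = 0"
    using sA iA isn by (simp add: distrib_right)
  have "complex_of_real (indicator A (X w)) * iexp (t * Y w) =
    complex_of_real (cos (t * Y w) * indicator A (X w)) + \<i> * complex_of_real (sin (t * Y w) * indicator A (X w))" for w
    by (simp only: cis_conv_exp[symmetric]) (simp add: complex_eq_iff)
  then have "(CLINT w|M. complex_of_real (indicator A (X w)) * iexp (t * Y w)) =
     (CLINT w|M. complex_of_real (cos (t * Y w) * indicator A (X w)) + \<i> * complex_of_real (sin (t * Y w) * indicator A (X w)))"
    by simp
  also have "\<dots> = complex_of_real (?e * ?p) + \<i> * complex_of_real 0"
    unfolding cA'[symmetric] sA'[symmetric]
    using ic isn by (subst Bochner_Integration.integral_add)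
      (simp_all only: integral_mult_right_zero integral_complex_of_real complex_of_real_integrable_eq integrable_mult_right)
  finally show ?thesis unfolding chY by (simp add: mult.commute)
qed

text \<open>A second reweighting with the roles exchanged: the weight is now
  \<open>indicator A (X w)\<close> and the variable is \<open>Y\<close>. This gives the product
  formula on preimages of Borel sets, which are closed under intersection and generate the two
  sigma-algebras.\<close>

lemma (in prob_space) gauss_pair_indep:
  assumes G: "gauss_pair M X Y u v 0"
  shows "indep_var borel X borel Y"
proof -
  note [measurable] = gauss_pair_measurable[OF G]
  have main: "prob ((X -` A \<inter> space M) \<inter> (Y -` B \<inter> space M)) = prob (X -` A \<inter> space M) * prob (Y -` B \<inter> space M)"
    if [measurable]: "A \<in> sets borel" "B \<in> sets borel" for A B
  proof -
    have "(LINT w|M. indicator A (X w) * indicator B (Y w) :: real) =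
       (LINT w|M. indicator A (X w)) * (LINT w|M. indicator B (Y w) :: real)"
      by (rule weighted_char_factor[where B=1]) (use gauss_pair_indep_char[OF G that(1)] in auto)
    moreover have "(LINT w|M. indicator A (X w)) = prob (X -` A \<inter> space M)"
      by (subst indicator_vimage[symmetric]) (simp add: Int_commute)
    moreover have "(LINT w|M. indicator B (Y w)) = prob (Y -` B \<inter> space M)"
      by (subst indicator_vimage[symmetric]) (simp add: Int_commute)
    moreover have "(LINT w|M. indicator A (X w) * indicator B (Y w) :: real) = (LINT w|M. indicator ((X -` A \<inter> space M) \<inter> (Y -` B \<inter> space M)) w)"
      by (intro Bochner_Integration.integral_cong) (auto split: split_indicator)
    ultimately show ?thesis by simp
  qed
  show ?thesis
    unfolding indep_var_eq
  proof (intro conjI indep_set_sigma_sets indep_setI)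
    have "Int_stable {Z -` A \<inter> space M |A. A \<in> sets borel}" for Z :: "'a \<Rightarrow> real"
    proof (rule Int_stableI)
      fix a b assume "a \<in> {Z -` A \<inter> space M |A. A \<in> sets borel}" "b \<in> {Z -` A \<inter> space M |A. A \<in> sets borel}"
      then obtain A B where "A \<in> sets borel" "B \<in> sets borel" "a = Z -` A \<inter> space M" "b = Z -` B \<inter> space M"
        by blast
      then have "a \<inter> b = Z -` (A \<inter> B) \<inter> space M" "A \<inter> B \<in> sets borel" by auto
      then show "a \<inter> b \<in> {Z -` A \<inter> space M |A. A \<in> sets borel}" by blast
    qed
    then show "Int_stable {X -` A \<inter> space M |A. A \<in> sets borel}"
      "Int_stable {Y -` A \<inter> space M |A. A \<in> sets borel}" by blast+
  next
    fix a b assume "a \<in> {X -` A \<inter> space M |A. A \<in> sets borel}" "b \<in> {Y -` A \<inter> space M |A. A \<in> sets borel}"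
    then show "prob (a \<inter> b) = prob a * prob b" using main by blast
  qed (auto intro: measurable_sets)
qed

lemma (in prob_space) gauss_pair_normal:
  assumes G: "gauss_pair M X Y u v c" and u: "u > 0"
  shows "distributed M lborel X (normal_density 0 (sqrt u))"
proof -
  note [measurable] = gauss_pair_measurable[OF G]
  let ?Z = "\<lambda>w. X w / sqrt u"
  have "distr M borel ?Z = std_normal_distribution"
  proof (rule Levy_uniqueness)
    show "real_distribution (distr M borel ?Z)" by (rule real_distribution_distr) simp
    show "real_distribution std_normal_distribution" by (rule real_dist_normal_dist)
    have "char (distr M borel ?Z) t = complex_of_real (exp (- t\<^sup>2 / 2))" for t
    proof -
      have "char (distr M borel ?Z) t = (CLINT w|M. iexp ((t / sqrt u) * X w + 0 * Y w))"
        by (simp add: char_def integral_distr)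
      also have "\<dots> = complex_of_real (exp (- t\<^sup>2 / 2))"
        unfolding gauss_pair_char[OF G] using u by (simp add: power_divide)
      finally show ?thesis .
    qed
    then show "char (distr M borel ?Z) = char std_normal_distribution"
      by (simp add: char_std_normal_distribution fun_eq_iff)
  qed
  then have "distr M lborel ?Z = density lborel (\<lambda>x. ennreal (std_normal_density x))"
    by (metis distr_cong sets_lborel)
  then have "distributed M lborel ?Z std_normal_density"
    unfolding distributed_def by simp
  then show ?thesis
    using normal_standard_normal_convert[of "sqrt u" X 0] u by simp
qed

section \<open>Bussgang's formula and the arcsine law\<close>

lemma sgn1_measurable [measurable]: "sgn1 \<in> borel_measurable borel"
  unfolding sgn1_def by measurable

lemma abs_sgn1 [simp]: "\<bar>sgn1 x\<bar> = 1"
  by (simp add: sgn1_def)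

lemma sgn1_mult_self [simp]: "sgn1 x * sgn1 x = 1"
  by (simp add: sgn1_def)

lemma mult_sgn1 [simp]: "x * sgn1 x = \<bar>x\<bar>"
  by (simp add: sgn1_def)

lemma sgn1_mult_pos: "c > 0 \<Longrightarrow> sgn1 (c * x) = sgn1 x"
  by (simp add: sgn1_def zero_le_mult_iff)

lemma sign_change_measurable:
  "{(u, v). sgn1 (k * u + v) \<noteq> sgn1 v} \<in> sets (borel \<Otimes>\<^sub>M borel)"
proof -
  have "{(u, v). sgn1 (k * u + v) \<noteq> sgn1 v} =
      {x \<in> space (borel \<Otimes>\<^sub>M borel). sgn1 (k * fst x + snd x) \<noteq> sgn1 (snd x)}"
    by (auto simp: space_pair_measure)
  also have "\<dots> \<in> sets (borel \<Otimes>\<^sub>M borel)" by measurable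
  finally show ?thesis .
qed

context prob_space
begin

lemma integrable_sgn1: "X \<in> borel_measurable M \<Longrightarrow> integrable M (\<lambda>w. sgn1 (X w))"
  by (intro integrable_const_bound[where B=1]) auto

lemma integrable_sgn1_mult:
  "X \<in> borel_measurable M \<Longrightarrow> Y \<in> borel_measurable M \<Longrightarrow> integrable M (\<lambda>w. sgn1 (X w) * sgn1 (Y w))"
  by (intro integrable_const_bound[where B=1]) (auto simp: abs_mult)

lemma gauss_pair_moments:
  assumes G: "gauss_pair M X Y u v c" and u: "u > 0"
  shows "integrable M X" "expectation X = 0"
    and "integrable M (\<lambda>w. (X w)\<^sup>2)" "expectation (\<lambda>w. (X w)\<^sup>2) = u"
    and "expectation (\<lambda>w. \<bar>X w\<bar>) = sqrt (2 * u / pi)"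
    and "expectation (\<lambda>w. sgn1 (X w)) = 0"
proof -
  note [measurable] = gauss_pair_measurable[OF G]
  note D = gauss_pair_normal[OF G u]
  have su: "sqrt u > 0" using u by simp
  have nn: "AE x in lborel. 0 \<le> normal_density 0 (sqrt u) x" by simp
  have ie: "integrable lborel (\<lambda>x. normal_density 0 (sqrt u) x * g x) = integrable M (\<lambda>w. g (X w))"
    if "g \<in> borel_measurable borel" for g :: "real \<Rightarrow> real"
    by (rule distributed_integrable[OF D]) (use that in auto)
  have ei: "(LINT x|lborel. normal_density 0 (sqrt u) x * g x) = expectation (\<lambda>w. g (X w))"
    if "g \<in> borel_measurable borel" for g :: "real \<Rightarrow> real"
    by (rule distributed_integral[OF D]) (use that in auto)
  show "integrable M X" using ie[of "\<lambda>x. x"] integrable_normal_moment_nz_1[OF su, of 0] by simp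
  show "expectation X = 0" using ei[of "\<lambda>x. x"] integral_normal_moment_nz_1[OF su, of 0] by simp
  show "integrable M (\<lambda>w. (X w)\<^sup>2)" using ie[of "\<lambda>x. x\<^sup>2"] integrable_normal_moment[OF su, of 0 2] by simp
  show "expectation (\<lambda>w. (X w)\<^sup>2) = u"
    using ei[of "\<lambda>x. x\<^sup>2"] integral_normal_moment_even[OF su, of 0 1] u by simp
  show "expectation (\<lambda>w. \<bar>X w\<bar>) = sqrt (2 * u / pi)"
    using ei[of "\<lambda>x. \<bar>x\<bar>"] integral_normal_moment_abs_odd[OF su, of 0 0] u
    by (simp add: real_sqrt_mult real_sqrt_divide)
  \<comment> \<open>\<open>sgn1\<close> is not odd, since \<open>sgn1 0 = 1\<close>. The reflection
    argument is therefore run with the odd function \<open>sgn\<close>, which differs from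
    \<open>sgn1\<close> only on a null set.\<close>
  have "has_bochner_integral lborel (\<lambda>x. normal_density 0 (sqrt u) x * sgn x) 0"
  proof -
    have "integrable lborel (\<lambda>x. normal_density 0 (sqrt u) x * sgn x)"
      by (rule Bochner_Integration.integrable_bound[OF integrable_normal_density[OF su]])
         (auto simp: abs_mult abs_sgn_eq)
    moreover have "(LINT x|lborel. normal_density 0 (sqrt u) x * sgn x) = 0"
    proof -
      have "(LINT x|lborel. normal_density 0 (sqrt u) x * sgn x) =
         (LINT x|lborel. normal_density 0 (sqrt u) (- x) * sgn (- x))"
        using lborel_integral_real_affine[of "-1" "\<lambda>x. normal_density 0 (sqrt u) x * sgn x" 0] by simp
      also have "\<dots> = - (LINT x|lborel. normal_density 0 (sqrt u) x * sgn x)"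
        by (simp add: normal_density_def)
      finally show ?thesis by simp
    qed
    ultimately show ?thesis by (simp add: has_bochner_integral_iff)
  qed
  then have "(LINT x|lborel. normal_density 0 (sqrt u) x * sgn x) = 0"
    by (rule has_bochner_integral_integral_eq)
  moreover have "(LINT x|lborel. normal_density 0 (sqrt u) x * sgn x) = (LINT x|lborel. normal_density 0 (sqrt u) x * sgn1 x)"
    by (intro integral_cong_AE eventually_mono[OF AE_lborel_singleton[of 0]]) (auto simp: sgn1_def sgn_if)
  ultimately show "expectation (\<lambda>w. sgn1 (X w)) = 0"
    using ei[of sgn1] by simp
qed

text \<open>The residual \<open>R = X - (c / v) * Y\<close> is uncorrelated with \<open>Y\<close>,
  hence independent of \<open>f (Y w)\<close>, and its mean 0 removes it from the product. When
  \<open>X\<close> is a multiple of \<open>Y\<close> the residual has variance 0; this is where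
  degenerate pairs occur.\<close>

lemma gauss_pair_regression:
  assumes G: "gauss_pair M X Y u v c" and "u > 0" and v: "v > 0"
    and f[measurable]: "f \<in> borel_measurable borel" and "integrable M (\<lambda>w. f (Y w))"
    and "integrable M (\<lambda>w. Y w * f (Y w))"
  shows "integrable M (\<lambda>w. X w * f (Y w))"
    and "expectation (\<lambda>w. X w * f (Y w)) = c / v * expectation (\<lambda>w. Y w * f (Y w))"
proof -
  define R where "R w = 1 * X w + (- c / v) * Y w" for w
  have GR: "gauss_pair M R Y (1\<^sup>2 * u + 2 * 1 * (- c / v) * c + (- c / v)\<^sup>2 * v) v 0"
    using gauss_pair_linear[OF G, of 1 "- c / v" 0 1] v unfolding R_def by simp
  have GY: "gauss_pair M Y X v u c"
    using gauss_pair_linear[OF G, of 0 1 1 0] by simp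
  note X = gauss_pair_moments[OF G assms(2)]
  note Y = gauss_pair_moments[OF GY v]
  have R: "integrable M R" "expectation R = 0"
    using X(1,2) Y(1,2) unfolding R_def by auto
  have "indep_var borel R borel (\<lambda>w. f (Y w))"
    using indep_var_compose[OF gauss_pair_indep[OF GR], of "\<lambda>x. x" borel f borel] f by (simp add: comp_def)
  note RF = indep_var_lebesgue_integral[OF this R(1) assms(5)] indep_var_integrable[OF this R(1) assms(5)]
  have eq: "X w * f (Y w) = R w * f (Y w) + c / v * (Y w * f (Y w))" for w
    unfolding R_def by (simp add: algebra_simps)
  show "integrable M (\<lambda>w. X w * f (Y w))"
    unfolding eq using RF(2) assms(6) by auto
  show "expectation (\<lambda>w. X w * f (Y w)) = c / v * expectation (\<lambda>w. Y w * f (Y w))"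
    unfolding eq using RF assms(6) R(2) by simp
qed

text \<open>Regression with \<open>f\<close> the identity: the parameter \<open>c\<close> of the
  characteristic function is the covariance in the usual sense.\<close>

lemma gauss_pair_covariance:
  assumes G: "gauss_pair M X Y u v c" and u: "u > 0" and v: "v > 0"
  shows "integrable M (\<lambda>w. X w * Y w)" "expectation (\<lambda>w. X w * Y w) = c"
proof -
  have GY: "gauss_pair M Y X v u c"
    using gauss_pair_linear[OF G, of 0 1 1 0] by simp
  note Y = gauss_pair_moments[OF GY v]
  note * = gauss_pair_regression[OF G u v, of "\<lambda>x. x"]
  show "integrable M (\<lambda>w. X w * Y w)" "expectation (\<lambda>w. X w * Y w) = c"
    using * Y v by (auto simp: power2_eq_square)
qed

text \<open>Regression with \<open>f = sgn1\<close>. Since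
  \<open>Y * sgn1 Y = \<bar>Y\<bar>\<close>, the constant is the mean absolute value
  \<open>sqrt (2 * v / pi)\<close> divided by the variance \<open>v\<close>.\<close>

lemma gauss_pair_bussgang:
  assumes G: "gauss_pair M X Y u v c" and u: "u > 0" and v: "v > 0"
  shows "integrable M (\<lambda>w. X w * sgn1 (Y w))"
    and "expectation (\<lambda>w. X w * sgn1 (Y w)) = sqrt (2 / (pi * v)) * c"
proof -
  have GY: "gauss_pair M Y X v u c"
    using gauss_pair_linear[OF G, of 0 1 1 0] by simp
  note Y = gauss_pair_moments[OF GY v]
  have [measurable]: "Y \<in> borel_measurable M" using gauss_pair_measurable[OF G] by simp
  note * = gauss_pair_regression[OF G u v sgn1_measurable integrable_sgn1]
  show "integrable M (\<lambda>w. X w * sgn1 (Y w))" using * Y(1) by simp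
  have "expectation (\<lambda>w. X w * sgn1 (Y w)) = c / v * sqrt (2 * v / pi)"
    using * Y(1,5) by simp
  also have "\<dots> = sqrt (2 / (pi * v)) * c"
    using v by (simp add: real_sqrt_mult real_sqrt_divide field_simps)
  finally show "expectation (\<lambda>w. X w * sgn1 (Y w)) = sqrt (2 / (pi * v)) * c" .
qed

text \<open>The ratio of independent centred Gaussians is Cauchy distributed.\<close>

lemma std_normal_sign_change_nn_integral:
  assumes k: "k \<ge> 0"
  shows "(\<integral>\<^sup>+ u. \<integral>\<^sup>+ v. ennreal (std_normal_density u) * ennreal (std_normal_density v) *
      indicator {(u, v). sgn1 (k * u + v) \<noteq> sgn1 v} (u, v) \<partial>lborel \<partial>lborel) = ennreal (arctan k / pi)"
proof -
  let ?\<phi> = "std_normal_density"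
  let ?S = "{(u, v). sgn1 (k * u + v) \<noteq> sgn1 v}"
  have [measurable]: "?S \<in> sets (borel \<Otimes>\<^sub>M borel)"
    by (rule sign_change_measurable)
  \<comment> \<open>Substituting \<open>v = - u * w\<close> gives
    \<open>k * u + v = u * (k - w)\<close>, so for either sign of \<open>u\<close> the sign changes
    exactly for \<open>w\<close> strictly between 0 and \<open>k\<close>. The two end points are
    null, and the factor \<open>\<bar>u\<bar>\<close> is the Jacobian.\<close>
  have sub: "(\<integral>\<^sup>+ v. ennreal (?\<phi> u) * ennreal (?\<phi> v) * indicator ?S (u, v) \<partial>lborel) =
     (\<integral>\<^sup>+ w. ennreal (\<bar>u\<bar> * ?\<phi> u * ?\<phi> (u * w)) * indicator {0..k} w \<partial>lborel)" if u: "u \<noteq> 0" for u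
  proof -
    have "(\<integral>\<^sup>+ v. ennreal (?\<phi> u) * ennreal (?\<phi> v) * indicator ?S (u, v) \<partial>lborel) =
       ennreal \<bar>- u\<bar> * (\<integral>\<^sup>+ w. ennreal (?\<phi> u) * ennreal (?\<phi> (0 + (- u) * w)) * indicator ?S (u, 0 + (- u) * w) \<partial>lborel)"
      using u by (intro nn_integral_real_affine) auto
    also have "\<dots> = (\<integral>\<^sup>+ w. ennreal \<bar>u\<bar> * (ennreal (?\<phi> u) * ennreal (?\<phi> (0 + (- u) * w)) * indicator ?S (u, 0 + (- u) * w)) \<partial>lborel)"
      by (subst nn_integral_cmult) auto
    also have "\<dots> = (\<integral>\<^sup>+ w. ennreal (\<bar>u\<bar> * ?\<phi> u * ?\<phi> (u * w)) * indicator {0..k} w \<partial>lborel)"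
    proof (intro nn_integral_cong_AE)
      show "AE w in lborel. ennreal \<bar>u\<bar> * (ennreal (?\<phi> u) * ennreal (?\<phi> (0 + (- u) * w)) * indicator ?S (u, 0 + (- u) * w)) =
         ennreal (\<bar>u\<bar> * ?\<phi> u * ?\<phi> (u * w)) * indicator {0..k} w"
        using AE_lborel_singleton[of 0] AE_lborel_singleton[of k]
      proof eventually_elim
        case (elim w)
        have "k * u + (0 + (- u) * w) = u * (k - w)" by (simp add: algebra_simps)
        then have "indicator ?S (u, 0 + (- u) * w) = (indicator {0..k} w :: ennreal)"
          using elim u k
          by (auto simp: indicator_def sgn1_def zero_le_mult_iff mult_le_0_iff split: if_splits)
        moreover have "?\<phi> (0 + (- u) * w) = ?\<phi> (u * w)" by (simp add: normal_density_def)
        ultimately show ?case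
          by (simp only:) (simp add: ennreal_mult mult.assoc)
      qed
    qed
    finally show ?thesis .
  qed
  \<comment> \<open>As a function of \<open>u\<close> the product of the two densities is a multiple
    of a Gaussian density of variance \<open>1 / (1 + w\<^sup>2)\<close>. The integral is its first
    absolute moment, and the result, as a function of \<open>w\<close>, is the Cauchy
    density.\<close>
  have inner: "(\<integral>\<^sup>+ u. ennreal (\<bar>u\<bar> * ?\<phi> u * ?\<phi> (u * w)) \<partial>lborel) = ennreal (1 / (pi * (1 + w\<^sup>2)))" for w
  proof -
    define s where "s = 1 / sqrt (1 + w\<^sup>2)"
    have w: "1 + w\<^sup>2 > 0" by (simp add: add_pos_nonneg)
    have s: "s > 0" using w by (simp add: s_def)
    have s2: "s\<^sup>2 = 1 / (1 + w\<^sup>2)" using w by (simp add: s_def power_divide)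
    have "?\<phi> u * ?\<phi> (u * w) = s / sqrt (2 * pi) * normal_density 0 s u" for u
    proof -
      have "normal_density 0 s u = 1 / (s * sqrt (2 * pi)) * exp (- u\<^sup>2 * (1 + w\<^sup>2) / 2)"
        unfolding normal_density_def s2 real_sqrt_mult using s by (simp add: s_def real_sqrt_divide real_sqrt_mult)
      then show ?thesis
        using s by (simp add: std_normal_density_def exp_add[symmetric] algebra_simps power_mult_distrib add_divide_distrib diff_divide_distrib)
    qed
    then have "(\<integral>\<^sup>+ u. ennreal (\<bar>u\<bar> * ?\<phi> u * ?\<phi> (u * w)) \<partial>lborel) =
       (\<integral>\<^sup>+ u. ennreal (s / sqrt (2 * pi) * (normal_density 0 s u * \<bar>u - 0\<bar> ^ (2 * 0 + 1))) \<partial>lborel)"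
      by (intro nn_integral_cong arg_cong[where f=ennreal]) (simp add: algebra_simps)
    also have "\<dots> = ennreal (LINT u|lborel. s / sqrt (2 * pi) * (normal_density 0 s u * \<bar>u - 0\<bar> ^ (2 * 0 + 1)))"
      using s by (intro nn_integral_eq_integral integrable_mult_right integrable_normal_moment_abs) auto
    also have "(LINT u|lborel. s / sqrt (2 * pi) * (normal_density 0 s u * \<bar>u - 0\<bar> ^ (2 * 0 + 1))) =
       s / sqrt (2 * pi) * (s * sqrt (2 / pi))"
      using integral_normal_moment_abs_odd[OF s, of 0 0] by simp
    also have "\<dots> = s\<^sup>2 / pi"
      by (simp add: real_sqrt_mult real_sqrt_divide field_simps power2_eq_square)
    also have "\<dots> = 1 / (pi * (1 + w\<^sup>2))" using s2 by simp
    finally show ?thesis .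
  qed
  have "(\<integral>\<^sup>+ u. \<integral>\<^sup>+ v. ennreal (?\<phi> u) * ennreal (?\<phi> v) * indicator ?S (u, v) \<partial>lborel \<partial>lborel) =
     (\<integral>\<^sup>+ u. \<integral>\<^sup>+ w. ennreal (\<bar>u\<bar> * ?\<phi> u * ?\<phi> (u * w)) * indicator {0..k} w \<partial>lborel \<partial>lborel)"
    using AE_lborel_singleton[of 0] by (intro nn_integral_cong_AE) (auto simp: sub)
  also have "\<dots> = (\<integral>\<^sup>+ w. \<integral>\<^sup>+ u. ennreal (\<bar>u\<bar> * ?\<phi> u * ?\<phi> (u * w)) * indicator {0..k} w \<partial>lborel \<partial>lborel)"
    by (rule lborel_pair.Fubini') measurable
  also have "\<dots> = (\<integral>\<^sup>+ w. ennreal (1 / (pi * (1 + w\<^sup>2))) * indicator {0..k} w \<partial>lborel)"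
    by (intro nn_integral_cong, subst nn_integral_multc) (auto simp: inner)
  also have "\<dots> = ennreal (arctan k / pi - arctan 0 / pi)"
  proof (rule nn_integral_FTC_Icc)
    show "((\<lambda>w. arctan w / pi) has_real_derivative 1 / (pi * (1 + w\<^sup>2))) (at w)" for w
      using DERIV_cdivide[OF DERIV_arctan, of pi w]
      by (simp add: inverse_eq_divide mult.commute)
  qed (use k in \<open>auto simp: add_nonneg_nonneg\<close>)
  finally show ?thesis by simp
qed

text \<open>The signs of \<open>U\<close> and \<open>V\<close> are independent with mean 0, so all
  correlation comes from the event that adding \<open>k * U\<close> flips the sign of
  \<open>V\<close>, whose probability is \<open>arctan k / pi\<close>.\<close>

lemma std_gauss_pair_sgn1:
  assumes G: "gauss_pair M U V 1 1 0" and k: "k \<ge> 0"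
  shows "expectation (\<lambda>w. sgn1 (U w) * sgn1 (k * U w + V w)) = 2 / pi * arctan k"
proof -
  note [measurable] = gauss_pair_measurable[OF G]
  let ?\<phi> = "std_normal_density"
  let ?S = "{(u, v). sgn1 (k * u + v) \<noteq> sgn1 v}"
  have S[measurable]: "?S \<in> sets (borel \<Otimes>\<^sub>M borel)"
    by (rule sign_change_measurable)
  have GV: "gauss_pair M V U 1 1 0"
    using gauss_pair_linear[OF G, of 0 1 1 0] by simp
  have ind: "indep_var borel U borel V" by (rule gauss_pair_indep[OF G])
  have "distributed M lborel U ?\<phi>" "distributed M lborel V ?\<phi>"
    using gauss_pair_normal[OF G] gauss_pair_normal[OF GV] by simp_all
  moreover have "indep_var lborel U lborel V"
    using ind unfolding indep_var_eq by simp
  ultimately have D: "distributed M (lborel \<Otimes>\<^sub>M lborel) (\<lambda>w. (U w, V w)) (\<lambda>(u, v). ennreal (?\<phi> u) * ennreal (?\<phi> v))"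
    by (intro distributed_joint_indep) (auto intro: sigma_finite_lborel)
  have E: "{w \<in> space M. (U w, V w) \<in> ?S} \<in> events" by measurable
  have "emeasure M {w \<in> space M. (U w, V w) \<in> ?S} = (\<integral>\<^sup>+ w. indicator {w \<in> space M. (U w, V w) \<in> ?S} w \<partial>M)"
    by (rule nn_integral_indicator[OF E, symmetric])
  also have "\<dots> = (\<integral>\<^sup>+ w. indicator ?S (U w, V w) \<partial>M)"
    by (intro nn_integral_cong) (auto split: split_indicator)
  also have "\<dots> = (\<integral>\<^sup>+ x. (case x of (u, v) \<Rightarrow> ennreal (?\<phi> u) * ennreal (?\<phi> v)) * indicator ?S x \<partial>(lborel \<Otimes>\<^sub>M lborel))"
    by (rule distributed_nn_integral[OF D, symmetric]) measurable
  also have "\<dots> = (\<integral>\<^sup>+ u. \<integral>\<^sup>+ v. ennreal (?\<phi> u) * ennreal (?\<phi> v) * indicator ?S (u, v) \<partial>lborel \<partial>lborel)"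
    by (subst lborel.nn_integral_fst[symmetric]) auto
  also have "\<dots> = ennreal (arctan k / pi)" by (rule std_normal_sign_change_nn_integral[OF k])
  finally have P: "prob {w \<in> space M. (U w, V w) \<in> ?S} = arctan k / pi"
    using k by (simp add: measure_def)
  \<comment> \<open>A flip can only move the sign of \<open>V\<close> to that of \<open>U\<close>,
    because \<open>k\<close> is nonnegative. The product then jumps from -1 to 1, hence the factor
    2.\<close>
  have "sgn1 (U w) * sgn1 (k * U w + V w) = sgn1 (U w) * sgn1 (V w) + 2 * indicator {w \<in> space M. (U w, V w) \<in> ?S} w" if "w \<in> space M" for w
  proof -
    have "U w > 0 \<Longrightarrow> k * U w \<ge> 0" "U w < 0 \<Longrightarrow> k * U w \<le> 0" using k by (auto simp: mult_nonneg_nonpos)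
    then show ?thesis using that by (cases "U w" "0::real" rule: linorder_cases) (auto simp: sgn1_def)
  qed
  then have "expectation (\<lambda>w. sgn1 (U w) * sgn1 (k * U w + V w)) =
     expectation (\<lambda>w. sgn1 (U w) * sgn1 (V w) + 2 * indicator {w \<in> space M. (U w, V w) \<in> ?S} w)"
    by (intro Bochner_Integration.integral_cong) auto
  also have "\<dots> = expectation (\<lambda>w. sgn1 (U w) * sgn1 (V w)) + 2 * (arctan k / pi)"
    by (subst Bochner_Integration.integral_add)
      (use P in \<open>auto simp: integrable_sgn1_mult emeasure_eq_measure intro!: integrable_real_indicator\<close>)
  also have "expectation (\<lambda>w. sgn1 (U w) * sgn1 (V w)) = expectation (\<lambda>w. sgn1 (U w)) * expectation (\<lambda>w. sgn1 (V w))"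
    using indep_var_compose[OF ind sgn1_measurable sgn1_measurable]
    by (intro indep_var_lebesgue_integral integrable_sgn1) (simp_all add: comp_def)
  also have "\<dots> = 0" using gauss_pair_moments(6)[OF G] by simp
  finally show ?thesis by simp
qed

text \<open>Gram-Schmidt: \<open>U\<close> is \<open>X\<close> standardised and \<open>V\<close> is
  the standardised residual of \<open>Y\<close> given \<open>X\<close>, so that \<open>Y\<close> is
  a positive multiple of \<open>(r / t) * U + V\<close>. The angle satisfies
  \<open>arctan (r / sqrt (1 - r\<^sup>2)) = arcsin r\<close>. For \<open>r = 1\<close> there is no
  residual to standardise.\<close>

theorem gauss_pair_arcsine:
  assumes G: "gauss_pair M X Y v v (r * v)" and v: "v > 0" and r: "0 \<le> r" "r < 1"
  shows "expectation (\<lambda>w. sgn1 (X w) * sgn1 (Y w)) = 2 / pi * arcsin r"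
proof -
  define t where "t = sqrt (1 - r\<^sup>2)"
  have r2: "r\<^sup>2 < 1" using r by (simp add: power_less_one_iff abs_square_less_1)
  then have t: "t > 0" "t\<^sup>2 = 1 - r\<^sup>2" by (simp_all add: t_def)
  define U where "U w = (1 / sqrt v) * X w + 0 * Y w" for w
  define V where "V w = (- r / (t * sqrt v)) * X w + (1 / (t * sqrt v)) * Y w" for w
  have "gauss_pair M U V 1 1 0"
  proof -
    have "(1 / sqrt v)\<^sup>2 * v = 1" using v by (simp add: power_divide)
    moreover have "(- r / (t * sqrt v))\<^sup>2 * v + 2 * (- r / (t * sqrt v)) * (1 / (t * sqrt v)) * (r * v) + (1 / (t * sqrt v))\<^sup>2 * v = 1"
    proof -
      define q where "q = t * sqrt v"
      have q: "q \<noteq> 0" "q\<^sup>2 = (1 - r\<^sup>2) * v" using t v by (auto simp: q_def power_mult_distrib)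
      have "(- r / q)\<^sup>2 * v + 2 * (- r / q) * (1 / q) * (r * v) + (1 / q)\<^sup>2 * v = (1 - r\<^sup>2) * v / q\<^sup>2"
        using q(1) by (simp add: power2_eq_square field_simps)
      then show ?thesis using q r2 v unfolding q_def[symmetric] by simp
    qed
    moreover have "(1 / sqrt v) * (- r / (t * sqrt v)) * v + ((1 / sqrt v) * (1 / (t * sqrt v)) + 0 * (- r / (t * sqrt v))) * (r * v) + 0 * (1 / (t * sqrt v)) * v = 0"
      using v by (simp add: field_simps)
    ultimately show ?thesis
      using gauss_pair_linear[OF G, of "1 / sqrt v" 0 "- r / (t * sqrt v)" "1 / (t * sqrt v)"]
      unfolding U_def V_def by simp
  qed
  from std_gauss_pair_sgn1[OF this, of "r / t"] r t
  have *: "expectation (\<lambda>w. sgn1 (U w) * sgn1 (r / t * U w + V w)) = 2 / pi * arctan (r / t)" by simp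
  have U: "sgn1 (U w) = sgn1 (X w)" for w
    unfolding U_def using sgn1_mult_pos[of "1 / sqrt v" "X w"] v by simp
  have "r / t * U w + V w = (1 / (t * sqrt v)) * Y w" for w
    unfolding U_def V_def using t v by (simp add: field_simps)
  then have Y: "sgn1 (r / t * U w + V w) = sgn1 (Y w)" for w
    using sgn1_mult_pos[of "1 / (t * sqrt v)" "Y w"] t v by simp
  have "arctan (r / t) = arcsin r"
    using arcsin_arctan[of r] r unfolding t_def by simp
  with * U Y show ?thesis by simp
qed

end

section \<open>The block covariance matrix\<close>

lemma mat_adjoint_index [simp]:
  fixes A :: "complex mat"
  assumes "i < dim_col A" "j < dim_row A"
  shows "mat_adjoint A $$ (i, j) = cnj (A $$ (j, i))"
  using assms by (simp add: mat_adjoint_def mat_of_rows_def cols_def)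

lemma mat_adjoint_dim [simp]:
  fixes A :: "complex mat"
  shows "dim_row (mat_adjoint A) = dim_col A" "dim_col (mat_adjoint A) = dim_row A"
  by (auto simp: mat_adjoint_def)

lemma mat_adjoint_carrier [simp]:
  fixes A :: "complex mat"
  shows "A \<in> carrier_mat m n \<Longrightarrow> mat_adjoint A \<in> carrier_mat n m"
  by (intro carrier_matI) simp_all

text \<open>A trivial kernel makes the determinant nonzero, so \<open>mat_inverse\<close> returns
  \<open>Some\<close> matrix. This is what gives meaning to the \<open>the\<close> inside
  \<open>lmmse\<close>.\<close>

lemma inj_mat_inverse:
  fixes C :: "complex mat"
  assumes C: "C \<in> carrier_mat n n"
    and inj: "\<And>v. v \<in> carrier_vec n \<Longrightarrow> C *\<^sub>v v = 0\<^sub>v n \<Longrightarrow> v = 0\<^sub>v n"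
  obtains B where "mat_inverse C = Some B" "B \<in> carrier_mat n n" "C * B = 1\<^sub>m n" "B * C = 1\<^sub>m n"
proof -
  have "det C \<noteq> 0" using det_0_iff_vec_prod_zero[OF C] inj by auto
  then have "C \<in> Units (ring_mat TYPE(complex) n n)" by (rule det_non_zero_imp_unit[OF C])
  then have "mat_inverse C \<noteq> None" using mat_inverse(1)[OF C, of n] by auto
  then obtain B where "mat_inverse C = Some B" by auto
  with mat_inverse(2)[OF C this] that show ?thesis by blast
qed

lemma smult_mat_mult_vec:
  fixes A :: "complex mat"
  assumes "A \<in> carrier_mat m n" "v \<in> carrier_vec n"
  shows "(c \<cdot>\<^sub>m A) *\<^sub>v v = c \<cdot>\<^sub>v (A *\<^sub>v v)"
  using carrier_matD[OF assms(1)] carrier_vecD[OF assms(2)]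
  by (intro eq_vecI) (simp_all add: scalar_prod_def sum_distrib_left mult.assoc)

lemma one_smult_mat: "(1 :: complex) \<cdot>\<^sub>m A = A"
  by (intro eq_matI) auto

text \<open>Encoded as a four-block matrix whose lower blocks have no rows, so that the block
  multiplication rules apply directly.\<close>

definition row_block :: "complex mat \<Rightarrow> complex mat \<Rightarrow> complex mat" where
  "row_block X Y = four_block_mat X Y (0\<^sub>m 0 (dim_col X)) (0\<^sub>m 0 (dim_col Y))"

lemma row_block_carrier [simp]:
  "X \<in> carrier_mat m p \<Longrightarrow> Y \<in> carrier_mat m q \<Longrightarrow> row_block X Y \<in> carrier_mat m (p + q)"
  unfolding row_block_def by (intro carrier_matI) simp_all

lemma row_block_index [simp]:
  assumes "X \<in> carrier_mat m p" "Y \<in> carrier_mat m q" "i < m" "j < p + q"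
  shows "row_block X Y $$ (i, j) = (if j < p then X $$ (i, j) else Y $$ (i, j - p))"
  unfolding row_block_def using carrier_matD[OF assms(1)] carrier_matD[OF assms(2)] assms(3,4) by simp

lemma row_block_mult_vec:
  assumes X: "X \<in> carrier_mat m p" and Y: "Y \<in> carrier_mat m q"
    and u: "u \<in> carrier_vec p" and w: "w \<in> carrier_vec q"
  shows "row_block X Y *\<^sub>v (u @\<^sub>v w) = X *\<^sub>v u + Y *\<^sub>v w"
proof -
  have "row_block X Y *\<^sub>v (u @\<^sub>v w) = (X *\<^sub>v u + Y *\<^sub>v w) @\<^sub>v (0\<^sub>m 0 p *\<^sub>v u + 0\<^sub>m 0 q *\<^sub>v w)"
    unfolding row_block_def using X Y u w by (subst four_block_mat_mult_vec[of _ m p _ q _ 0]) auto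
  also have "\<dots> = X *\<^sub>v u + Y *\<^sub>v w"
    using X Y by (intro eq_vecI) auto
  finally show ?thesis .
qed

text \<open>The purely algebraic part of the model: \<open>s\<close> is the analog noise variance,
  \<open>A\<close> and \<open>B\<close> are the Gram constants. The expression in assumption
  \<open>D\<close> is the coefficient left in the quantized equation once the analog unknown has
  been eliminated. An absent part of the observation is the case \<open>p = 0\<close> or
  \<open>q = 0\<close>.\<close>

locale two_block_model =
  fixes H G :: "complex mat" and M p q :: nat and A B s \<kappa> \<alpha> \<gamma> :: complex
  assumes H [simp]: "H \<in> carrier_mat p M" and G [simp]: "G \<in> carrier_mat q M"
    and HH: "mat_adjoint H * H = A \<cdot>\<^sub>m 1\<^sub>m M" and GG: "mat_adjoint G * G = B \<cdot>\<^sub>m 1\<^sub>m M"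
    and s: "s \<noteq> 0" and \<alpha>: "\<alpha> \<noteq> 0" and As: "A + s \<noteq> 0"
    and D: "\<alpha> + (\<gamma> - \<kappa>\<^sup>2 * A / (A + s)) * B \<noteq> 0"
begin

definition C where
  "C = four_block_mat (H * mat_adjoint H + s \<cdot>\<^sub>m 1\<^sub>m p) (\<kappa> \<cdot>\<^sub>m (H * mat_adjoint G))
     (\<kappa> \<cdot>\<^sub>m (G * mat_adjoint H)) (\<alpha> \<cdot>\<^sub>m 1\<^sub>m q + \<gamma> \<cdot>\<^sub>m (G * mat_adjoint G))"

lemma adj_H [simp]: "mat_adjoint H \<in> carrier_mat M p" and adj_G [simp]: "mat_adjoint G \<in> carrier_mat M q"
  by auto

lemma dims [simp]: "dim_row H = p" "dim_col H = M" "dim_row G = q" "dim_col G = M"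
  using carrier_matD[OF H] carrier_matD[OF G] by auto

lemma gram_carriers [simp]:
  "H * mat_adjoint H \<in> carrier_mat p p" "H * mat_adjoint G \<in> carrier_mat p q"
  "G * mat_adjoint H \<in> carrier_mat q p" "G * mat_adjoint G \<in> carrier_mat q q"
  by (intro carrier_matI; simp)+

lemma block_carriers [simp]:
  "H * mat_adjoint H + s \<cdot>\<^sub>m 1\<^sub>m p \<in> carrier_mat p p" "\<kappa> \<cdot>\<^sub>m (H * mat_adjoint G) \<in> carrier_mat p q"
  "\<kappa> \<cdot>\<^sub>m (G * mat_adjoint H) \<in> carrier_mat q p" "\<alpha> \<cdot>\<^sub>m 1\<^sub>m q + \<gamma> \<cdot>\<^sub>m (G * mat_adjoint G) \<in> carrier_mat q q"
  by (intro carrier_matI; simp)+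

lemma C_carrier: "C \<in> carrier_mat (p + q) (p + q)"
  unfolding C_def by (intro four_block_carrier_mat block_carriers)

lemma adj_mult_H: "v \<in> carrier_vec M \<Longrightarrow> mat_adjoint H *\<^sub>v (H *\<^sub>v v) = A \<cdot>\<^sub>v v"
proof -
  assume v: "v \<in> carrier_vec M"
  have "mat_adjoint H *\<^sub>v (H *\<^sub>v v) = (mat_adjoint H * H) *\<^sub>v v"
    by (rule assoc_mult_mat_vec[OF adj_H H v, symmetric])
  also have "\<dots> = A \<cdot>\<^sub>v (1\<^sub>m M *\<^sub>v v)"
    unfolding HH by (rule smult_mat_mult_vec[OF one_carrier_mat v])
  finally show ?thesis using v by simp
qed

lemma adj_mult_G: "v \<in> carrier_vec M \<Longrightarrow> mat_adjoint G *\<^sub>v (G *\<^sub>v v) = B \<cdot>\<^sub>v v"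
proof -
  assume v: "v \<in> carrier_vec M"
  have "mat_adjoint G *\<^sub>v (G *\<^sub>v v) = (mat_adjoint G * G) *\<^sub>v v"
    by (rule assoc_mult_mat_vec[OF adj_G G v, symmetric])
  also have "\<dots> = B \<cdot>\<^sub>v (1\<^sub>m M *\<^sub>v v)"
    unfolding GG by (rule smult_mat_mult_vec[OF one_carrier_mat v])
  finally show ?thesis using v by simp
qed

text \<open>Projecting a kernel vector with \<open>H\<^sup>H\<close> and \<open>G\<^sup>H\<close> reduces the block system to a
  \<open>2 \<times> 2\<close> scalar one whose determinant is \<open>(A + s) * (\<alpha> + (\<gamma> - \<kappa>\<^sup>2 * A / (A + s)) * B)\<close>.\<close>

lemma C_inj:
  assumes v: "v \<in> carrier_vec (p + q)" and Cv: "C *\<^sub>v v = 0\<^sub>v (p + q)"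
  shows "v = 0\<^sub>v (p + q)"
proof -
  define u w where "u = vec_first v p" and "w = vec_last v q"
  have u [simp]: "u \<in> carrier_vec p" and w [simp]: "w \<in> carrier_vec q" unfolding u_def w_def by auto
  have vuw: "v = u @\<^sub>v w" unfolding u_def w_def using v by simp
  define x y where "x = mat_adjoint H *\<^sub>v u" and "y = mat_adjoint G *\<^sub>v w"
  have x [simp]: "x \<in> carrier_vec M" and y [simp]: "y \<in> carrier_vec M"
    unfolding x_def y_def by (rule mult_mat_vec_carrier[OF adj_H u], rule mult_mat_vec_carrier[OF adj_G w])
  have Hx [simp]: "H *\<^sub>v z \<in> carrier_vec p" "G *\<^sub>v z \<in> carrier_vec q" if "z \<in> carrier_vec M" for z
    by (rule mult_mat_vec_carrier[OF H that], rule mult_mat_vec_carrier[OF G that])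
  \<comment> \<open>Each block row is rewritten so that the kernel vector enters only through the
    projections \<open>x\<close> and \<open>y\<close>, apart from a scalar multiple of its own
    block. This is what lets the system close on \<open>x\<close> and \<open>y\<close>.\<close>
  have e1: "(H * mat_adjoint H + s \<cdot>\<^sub>m 1\<^sub>m p) *\<^sub>v u + (\<kappa> \<cdot>\<^sub>m (H * mat_adjoint G)) *\<^sub>v w = H *\<^sub>v (x + \<kappa> \<cdot>\<^sub>v y) + s \<cdot>\<^sub>v u"
  proof -
    have f1: "(H * mat_adjoint H + s \<cdot>\<^sub>m 1\<^sub>m p) *\<^sub>v u = (H * mat_adjoint H) *\<^sub>v u + (s \<cdot>\<^sub>m 1\<^sub>m p) *\<^sub>v u"
      by (rule add_mult_distrib_mat_vec[of _ p p]) simp_all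
    have f2: "(H * mat_adjoint H) *\<^sub>v u = H *\<^sub>v x"
      unfolding x_def by (rule assoc_mult_mat_vec[OF H adj_H u])
    have f3: "(s \<cdot>\<^sub>m 1\<^sub>m p) *\<^sub>v u = s \<cdot>\<^sub>v u"
      by (subst smult_mat_mult_vec[OF one_carrier_mat u]) simp
    have f4: "(\<kappa> \<cdot>\<^sub>m (H * mat_adjoint G)) *\<^sub>v w = \<kappa> \<cdot>\<^sub>v ((H * mat_adjoint G) *\<^sub>v w)"
      by (rule smult_mat_mult_vec[of _ p q]) simp_all
    have f5: "(H * mat_adjoint G) *\<^sub>v w = H *\<^sub>v y"
      unfolding y_def by (rule assoc_mult_mat_vec[OF H adj_G w])
    have f6: "H *\<^sub>v (x + \<kappa> \<cdot>\<^sub>v y) = H *\<^sub>v x + H *\<^sub>v (\<kappa> \<cdot>\<^sub>v y)"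
      by (rule mult_add_distrib_mat_vec[OF H x]) simp
    have f7: "H *\<^sub>v (\<kappa> \<cdot>\<^sub>v y) = \<kappa> \<cdot>\<^sub>v (H *\<^sub>v y)"
      by (rule mult_mat_vec[OF H y])
    show ?thesis
      unfolding f1 f2 f3 f4 f5 f6 f7
      by (intro eq_vecI) (simp_all add: carrier_vecD[OF u] carrier_vecD[OF w])
  qed
  have e2: "(\<kappa> \<cdot>\<^sub>m (G * mat_adjoint H)) *\<^sub>v u + (\<alpha> \<cdot>\<^sub>m 1\<^sub>m q + \<gamma> \<cdot>\<^sub>m (G * mat_adjoint G)) *\<^sub>v w = G *\<^sub>v (\<kappa> \<cdot>\<^sub>v x + \<gamma> \<cdot>\<^sub>v y) + \<alpha> \<cdot>\<^sub>v w"
  proof -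
    have f1: "(\<kappa> \<cdot>\<^sub>m (G * mat_adjoint H)) *\<^sub>v u = \<kappa> \<cdot>\<^sub>v ((G * mat_adjoint H) *\<^sub>v u)"
      by (rule smult_mat_mult_vec[of _ q p]) simp_all
    have f2: "(G * mat_adjoint H) *\<^sub>v u = G *\<^sub>v x"
      unfolding x_def by (rule assoc_mult_mat_vec[OF G adj_H u])
    have f3: "(\<alpha> \<cdot>\<^sub>m 1\<^sub>m q + \<gamma> \<cdot>\<^sub>m (G * mat_adjoint G)) *\<^sub>v w = (\<alpha> \<cdot>\<^sub>m 1\<^sub>m q) *\<^sub>v w + (\<gamma> \<cdot>\<^sub>m (G * mat_adjoint G)) *\<^sub>v w"
      by (rule add_mult_distrib_mat_vec[of _ q q]) simp_all
    have f4: "(\<alpha> \<cdot>\<^sub>m 1\<^sub>m q) *\<^sub>v w = \<alpha> \<cdot>\<^sub>v w"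
      by (subst smult_mat_mult_vec[OF one_carrier_mat w]) simp
    have f5: "(\<gamma> \<cdot>\<^sub>m (G * mat_adjoint G)) *\<^sub>v w = \<gamma> \<cdot>\<^sub>v ((G * mat_adjoint G) *\<^sub>v w)"
      by (rule smult_mat_mult_vec[of _ q q]) simp_all
    have f6: "(G * mat_adjoint G) *\<^sub>v w = G *\<^sub>v y"
      unfolding y_def by (rule assoc_mult_mat_vec[OF G adj_G w])
    have f7: "G *\<^sub>v (\<kappa> \<cdot>\<^sub>v x + \<gamma> \<cdot>\<^sub>v y) = G *\<^sub>v (\<kappa> \<cdot>\<^sub>v x) + G *\<^sub>v (\<gamma> \<cdot>\<^sub>v y)"
      by (rule mult_add_distrib_mat_vec[OF G]) simp_all
    have f8: "G *\<^sub>v (\<kappa> \<cdot>\<^sub>v x) = \<kappa> \<cdot>\<^sub>v (G *\<^sub>v x)" "G *\<^sub>v (\<gamma> \<cdot>\<^sub>v y) = \<gamma> \<cdot>\<^sub>v (G *\<^sub>v y)"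
      by (rule mult_mat_vec[OF G x], rule mult_mat_vec[OF G y])
    show ?thesis
      unfolding f1 f2 f3 f4 f5 f6 f7 f8
      by (intro eq_vecI) (simp_all add: carrier_vecD[OF u] carrier_vecD[OF w])
  qed
  have "(H *\<^sub>v (x + \<kappa> \<cdot>\<^sub>v y) + s \<cdot>\<^sub>v u) @\<^sub>v (G *\<^sub>v (\<kappa> \<cdot>\<^sub>v x + \<gamma> \<cdot>\<^sub>v y) + \<alpha> \<cdot>\<^sub>v w) = 0\<^sub>v p @\<^sub>v 0\<^sub>v q"
    using Cv four_block_mat_mult_vec[OF block_carriers u w] unfolding C_def vuw e1 e2
    by (simp only:) (intro eq_vecI, simp_all)
  moreover have "H *\<^sub>v (x + \<kappa> \<cdot>\<^sub>v y) + s \<cdot>\<^sub>v u \<in> carrier_vec p" by simp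
  ultimately have z: "H *\<^sub>v (x + \<kappa> \<cdot>\<^sub>v y) + s \<cdot>\<^sub>v u = 0\<^sub>v p" "G *\<^sub>v (\<kappa> \<cdot>\<^sub>v x + \<gamma> \<cdot>\<^sub>v y) + \<alpha> \<cdot>\<^sub>v w = 0\<^sub>v q"
    using append_vec_eq[of _ p "0\<^sub>v p"] by simp_all
  have "mat_adjoint H *\<^sub>v (H *\<^sub>v (x + \<kappa> \<cdot>\<^sub>v y) + s \<cdot>\<^sub>v u) = 0\<^sub>v M"
    unfolding z by (intro eq_vecI) simp_all
  moreover have "mat_adjoint H *\<^sub>v (H *\<^sub>v (x + \<kappa> \<cdot>\<^sub>v y) + s \<cdot>\<^sub>v u) = mat_adjoint H *\<^sub>v (H *\<^sub>v (x + \<kappa> \<cdot>\<^sub>v y)) + mat_adjoint H *\<^sub>v (s \<cdot>\<^sub>v u)"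
    by (rule mult_add_distrib_mat_vec[OF adj_H]) simp_all
  moreover have "mat_adjoint H *\<^sub>v (H *\<^sub>v (x + \<kappa> \<cdot>\<^sub>v y)) = A \<cdot>\<^sub>v (x + \<kappa> \<cdot>\<^sub>v y)"
    by (rule adj_mult_H) simp
  moreover have "mat_adjoint H *\<^sub>v (s \<cdot>\<^sub>v u) = s \<cdot>\<^sub>v x"
    unfolding x_def by (rule mult_mat_vec[OF adj_H u])
  ultimately have z1: "A \<cdot>\<^sub>v (x + \<kappa> \<cdot>\<^sub>v y) + s \<cdot>\<^sub>v x = 0\<^sub>v M" by simp
  have "mat_adjoint G *\<^sub>v (G *\<^sub>v (\<kappa> \<cdot>\<^sub>v x + \<gamma> \<cdot>\<^sub>v y) + \<alpha> \<cdot>\<^sub>v w) = 0\<^sub>v M"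
    unfolding z by (intro eq_vecI) simp_all
  moreover have "mat_adjoint G *\<^sub>v (G *\<^sub>v (\<kappa> \<cdot>\<^sub>v x + \<gamma> \<cdot>\<^sub>v y) + \<alpha> \<cdot>\<^sub>v w) = mat_adjoint G *\<^sub>v (G *\<^sub>v (\<kappa> \<cdot>\<^sub>v x + \<gamma> \<cdot>\<^sub>v y)) + mat_adjoint G *\<^sub>v (\<alpha> \<cdot>\<^sub>v w)"
    by (rule mult_add_distrib_mat_vec[OF adj_G]) simp_all
  moreover have "mat_adjoint G *\<^sub>v (G *\<^sub>v (\<kappa> \<cdot>\<^sub>v x + \<gamma> \<cdot>\<^sub>v y)) = B \<cdot>\<^sub>v (\<kappa> \<cdot>\<^sub>v x + \<gamma> \<cdot>\<^sub>v y)"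
    by (rule adj_mult_G) simp
  moreover have "mat_adjoint G *\<^sub>v (\<alpha> \<cdot>\<^sub>v w) = \<alpha> \<cdot>\<^sub>v y"
    unfolding y_def by (rule mult_mat_vec[OF adj_G w])
  ultimately have z2: "B \<cdot>\<^sub>v (\<kappa> \<cdot>\<^sub>v x + \<gamma> \<cdot>\<^sub>v y) + \<alpha> \<cdot>\<^sub>v y = 0\<^sub>v M" by simp
  have xy: "x $ i = 0 \<and> y $ i = 0" if i: "i < M" for i
  proof -
    have dims: "dim_vec x = M" "dim_vec y = M" using x y by auto
    have "(A \<cdot>\<^sub>v (x + \<kappa> \<cdot>\<^sub>v y) + s \<cdot>\<^sub>v x) $ i = 0" "(B \<cdot>\<^sub>v (\<kappa> \<cdot>\<^sub>v x + \<gamma> \<cdot>\<^sub>v y) + \<alpha> \<cdot>\<^sub>v y) $ i = 0"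
      using z1 z2 i by simp_all
    then have eq: "A * (x $ i + \<kappa> * y $ i) + s * x $ i = 0" "B * (\<kappa> * x $ i + \<gamma> * y $ i) + \<alpha> * y $ i = 0"
      using i dims by simp_all
    have "(A + s) * x $ i + A * \<kappa> * y $ i = A * (x $ i + \<kappa> * y $ i) + s * x $ i"
      by (simp add: algebra_simps)
    then have "(A + s) * x $ i = - (A * \<kappa> * y $ i)"
      using eq(1) by (simp add: eq_neg_iff_add_eq_0)
    then have xi: "x $ i = - (A * \<kappa> * y $ i) / (A + s)" using As by (simp add: field_simps)
    have "(\<alpha> + (\<gamma> - \<kappa>\<^sup>2 * A / (A + s)) * B) * y $ i = 0"
      using eq(2) unfolding xi by (simp add: algebra_simps power2_eq_square diff_divide_distrib)
    then have "y $ i = 0" using D by simp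
    then show ?thesis using xi by simp
  qed
  then have x0: "x = 0\<^sub>v M" and y0: "y = 0\<^sub>v M" using x y by (auto intro!: eq_vecI)
  \<comment> \<open>Back-substitution: once both projections vanish, the block equations read
    \<open>s u = 0\<close> and \<open>\<alpha> w = 0\<close>, with nonzero scalars.\<close>
  have "u = 0\<^sub>v p"
  proof (rule eq_vecI)
    fix i assume i: "i < dim_vec (0\<^sub>v p :: complex vec)"
    have "(H *\<^sub>v (x + \<kappa> \<cdot>\<^sub>v y) + s \<cdot>\<^sub>v u) $ i = 0" using z(1) i by simp
    moreover have "x + \<kappa> \<cdot>\<^sub>v y = 0\<^sub>v M" unfolding x0 y0 by (intro eq_vecI) auto
    moreover have "H *\<^sub>v 0\<^sub>v M = 0\<^sub>v p" using H by (intro eq_vecI) auto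
    ultimately show "u $ i = 0\<^sub>v p $ i" using i s by (simp add: carrier_vecD[OF u])
  qed (simp add: carrier_vecD[OF u])
  moreover have "w = 0\<^sub>v q"
  proof (rule eq_vecI)
    fix i assume i: "i < dim_vec (0\<^sub>v q :: complex vec)"
    have "(G *\<^sub>v (\<kappa> \<cdot>\<^sub>v x + \<gamma> \<cdot>\<^sub>v y) + \<alpha> \<cdot>\<^sub>v w) $ i = 0" using z(2) i by simp
    moreover have "\<kappa> \<cdot>\<^sub>v x + \<gamma> \<cdot>\<^sub>v y = 0\<^sub>v M" unfolding x0 y0 by (intro eq_vecI) auto
    moreover have "G *\<^sub>v 0\<^sub>v M = 0\<^sub>v q" using G by (intro eq_vecI) auto
    ultimately show "w $ i = 0\<^sub>v q $ i" using i \<alpha> by (simp add: carrier_vecD[OF w])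
  qed (simp add: carrier_vecD[OF w])
  ultimately show ?thesis unfolding vuw by (intro eq_vecI) auto
qed

text \<open>\<open>gain_a\<close> and \<open>gain_q\<close> are the Cramer solution of the system in
  \<open>gain_eqs\<close>. It arises from the ansatz that the blocks of the estimator matrix are
  multiples of the adjoints of \<open>H\<close> and \<open>G\<close>.\<close>

definition gain_a where
  "gain_a = 1 / (A + s) - \<kappa>\<^sup>2 * B * s / ((\<alpha> + (\<gamma> - \<kappa>\<^sup>2 * A / (A + s)) * B) * (A + s)\<^sup>2)"

definition gain_q where
  "gain_q = \<kappa> * s / ((\<alpha> + (\<gamma> - \<kappa>\<^sup>2 * A / (A + s)) * B) * (A + s))"

definition K where
  "K = row_block (gain_a \<cdot>\<^sub>m mat_adjoint H) (gain_q \<cdot>\<^sub>m mat_adjoint G)"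

lemma K_carrier: "K \<in> carrier_mat M (p + q)"
  unfolding K_def by simp

text \<open>These are the coefficients of the adjoints of \<open>H\<close> and \<open>G\<close> in
  the two block columns of \<open>K * C\<close>, compared with those of the
  cross-covariance.\<close>

lemma gain_eqs:
  "gain_a * (A + s) + gain_q * \<kappa> * B = 1"
  "gain_a * \<kappa> * A + gain_q * (\<alpha> + \<gamma> * B) = \<kappa>"
proof -
  define d where "d = \<alpha> + (\<gamma> - \<kappa>\<^sup>2 * A / (A + s)) * B"
  define t where "t = A + s"
  have d: "d \<noteq> 0" "t \<noteq> 0" using D As by (auto simp: d_def t_def)
  have ga: "gain_a = 1 / t - \<kappa>\<^sup>2 * B * s / (d * t\<^sup>2)" and gq: "gain_q = \<kappa> * s / (d * t)"
    unfolding gain_a_def gain_q_def d_def t_def by simp_all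
  show "gain_a * (A + s) + gain_q * \<kappa> * B = 1"
    unfolding ga gq t_def[symmetric] using d by (simp add: field_simps power2_eq_square)
  have al: "\<alpha> + \<gamma> * B = d + \<kappa>\<^sup>2 * A * B / t" unfolding d_def t_def by (simp add: algebra_simps)
  have "gain_a * \<kappa> * A + gain_q * (\<alpha> + \<gamma> * B) = \<kappa> * (A + s) / t"
    unfolding ga gq al using d by (simp add: field_simps power2_eq_square)
  then show "gain_a * \<kappa> * A + gain_q * (\<alpha> + \<gamma> * B) = \<kappa>" using d by (simp add: t_def)
qed

text \<open>The normal equations of linear estimation. The scalar Gram matrices collapse every
  triple product, so each block column stays a multiple of one adjoint and only the two scalar
  equations \<open>gain_eqs\<close> remain.\<close>

lemma K_mult_C: "K * C = row_block (mat_adjoint H) (\<kappa> \<cdot>\<^sub>m mat_adjoint G)"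
proof -
  let ?H = "mat_adjoint H" and ?G = "mat_adjoint G"
  have HHH: "?H * (H * X) = A \<cdot>\<^sub>m X" if "X \<in> carrier_mat M n" for X n
    using assoc_mult_mat[OF adj_H H that] that
    by (simp only: HH) (simp add: mult_smult_assoc_mat[OF one_carrier_mat])
  have GGG: "?G * (G * X) = B \<cdot>\<^sub>m X" if "X \<in> carrier_mat M n" for X n
    using assoc_mult_mat[OF adj_G G that] that
    by (simp only: GG) (simp add: mult_smult_assoc_mat[OF one_carrier_mat])
  have b1: "(gain_a \<cdot>\<^sub>m ?H) * (H * ?H + s \<cdot>\<^sub>m 1\<^sub>m p) + (gain_q \<cdot>\<^sub>m ?G) * (\<kappa> \<cdot>\<^sub>m (G * ?H)) = ?H"
  proof -
    have "?H * (H * ?H + s \<cdot>\<^sub>m 1\<^sub>m p) = A \<cdot>\<^sub>m ?H + s \<cdot>\<^sub>m ?H"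
      by (subst mult_add_distrib_mat[of _ M p _ p]) (simp_all add: HHH[OF adj_H] mult_smult_distrib[of _ M p _ p])
    moreover have "?G * (\<kappa> \<cdot>\<^sub>m (G * ?H)) = \<kappa> \<cdot>\<^sub>m (B \<cdot>\<^sub>m ?H)"
      by (subst mult_smult_distrib[of _ M q _ p]) (simp_all add: GGG[OF adj_H])
    ultimately have "(gain_a \<cdot>\<^sub>m ?H) * (H * ?H + s \<cdot>\<^sub>m 1\<^sub>m p) + (gain_q \<cdot>\<^sub>m ?G) * (\<kappa> \<cdot>\<^sub>m (G * ?H)) =
       gain_a \<cdot>\<^sub>m (A \<cdot>\<^sub>m ?H + s \<cdot>\<^sub>m ?H) + gain_q \<cdot>\<^sub>m (\<kappa> \<cdot>\<^sub>m (B \<cdot>\<^sub>m ?H))"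
      by (simp add: mult_smult_assoc_mat[of _ M p _ p] mult_smult_assoc_mat[of _ M q _ p])
    also have "\<dots> = (gain_a * (A + s) + gain_q * \<kappa> * B) \<cdot>\<^sub>m ?H"
      by (intro eq_matI) (auto simp: algebra_simps)
    finally show ?thesis unfolding gain_eqs one_smult_mat .
  qed
  have b2: "(gain_a \<cdot>\<^sub>m ?H) * (\<kappa> \<cdot>\<^sub>m (H * ?G)) + (gain_q \<cdot>\<^sub>m ?G) * (\<alpha> \<cdot>\<^sub>m 1\<^sub>m q + \<gamma> \<cdot>\<^sub>m (G * ?G)) = \<kappa> \<cdot>\<^sub>m ?G"
  proof -
    have "?G * (\<alpha> \<cdot>\<^sub>m 1\<^sub>m q + \<gamma> \<cdot>\<^sub>m (G * ?G)) = \<alpha> \<cdot>\<^sub>m ?G + \<gamma> \<cdot>\<^sub>m (B \<cdot>\<^sub>m ?G)"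
      by (subst mult_add_distrib_mat[of _ M q _ q]) (simp_all add: GGG[OF adj_G] mult_smult_distrib[of _ M q _ q])
    moreover have "?H * (\<kappa> \<cdot>\<^sub>m (H * ?G)) = \<kappa> \<cdot>\<^sub>m (A \<cdot>\<^sub>m ?G)"
      by (subst mult_smult_distrib[of _ M p _ q]) (simp_all add: HHH[OF adj_G])
    ultimately have "(gain_a \<cdot>\<^sub>m ?H) * (\<kappa> \<cdot>\<^sub>m (H * ?G)) + (gain_q \<cdot>\<^sub>m ?G) * (\<alpha> \<cdot>\<^sub>m 1\<^sub>m q + \<gamma> \<cdot>\<^sub>m (G * ?G)) =
       gain_a \<cdot>\<^sub>m (\<kappa> \<cdot>\<^sub>m (A \<cdot>\<^sub>m ?G)) + gain_q \<cdot>\<^sub>m (\<alpha> \<cdot>\<^sub>m ?G + \<gamma> \<cdot>\<^sub>m (B \<cdot>\<^sub>m ?G))"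
      by (simp add: mult_smult_assoc_mat[of _ M p _ q] mult_smult_assoc_mat[of _ M q _ q])
    also have "\<dots> = (gain_a * \<kappa> * A + gain_q * (\<alpha> + \<gamma> * B)) \<cdot>\<^sub>m ?G"
      by (intro eq_matI) (auto simp: algebra_simps)
    finally show ?thesis unfolding gain_eqs .
  qed
  have "K * C = four_block_mat ?H (\<kappa> \<cdot>\<^sub>m ?G)
      (0\<^sub>m 0 p * (H * ?H + s \<cdot>\<^sub>m 1\<^sub>m p) + 0\<^sub>m 0 q * (\<kappa> \<cdot>\<^sub>m (G * ?H)))
      (0\<^sub>m 0 p * (\<kappa> \<cdot>\<^sub>m (H * ?G)) + 0\<^sub>m 0 q * (\<alpha> \<cdot>\<^sub>m 1\<^sub>m q + \<gamma> \<cdot>\<^sub>m (G * ?G)))"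
    unfolding K_def C_def row_block_def
    using mult_four_block_mat[of "gain_a \<cdot>\<^sub>m ?H" M p "gain_q \<cdot>\<^sub>m ?G" q "0\<^sub>m 0 p" 0 "0\<^sub>m 0 q", OF _ _ _ _ block_carriers]
    by (simp only: b1 b2 index_smult_mat mat_adjoint_dim dims) simp
  also have "\<dots> = row_block ?H (\<kappa> \<cdot>\<^sub>m ?G)"
    unfolding row_block_def using carrier_matD[OF H] carrier_matD[OF G]
    by (intro cong_four_block_mat) auto
  finally show ?thesis .
qed

end

section \<open>Circular Gaussian families\<close>

context prob_space
begin

lemma complex_mult_cnj_expectation:
  fixes X W :: "'a \<Rightarrow> complex"
  assumes "integrable M (\<lambda>w. Re (X w) * Re (W w))" "expectation (\<lambda>w. Re (X w) * Re (W w)) = a"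
    and "integrable M (\<lambda>w. Im (X w) * Im (W w))" "expectation (\<lambda>w. Im (X w) * Im (W w)) = b"
    and "integrable M (\<lambda>w. Im (X w) * Re (W w))" "expectation (\<lambda>w. Im (X w) * Re (W w)) = c"
    and "integrable M (\<lambda>w. Re (X w) * Im (W w))" "expectation (\<lambda>w. Re (X w) * Im (W w)) = d"
  shows "integrable M (\<lambda>w. X w * cnj (W w))" "expectation (\<lambda>w. X w * cnj (W w)) = Complex (a + b) (c - d)"
proof -
  have eq: "X w * cnj (W w) = complex_of_real (Re (X w) * Re (W w) + Im (X w) * Im (W w))
     + \<i> * complex_of_real (Im (X w) * Re (W w) - Re (X w) * Im (W w))" for w
    by (simp add: complex_eq_iff)
  have i1: "integrable M (\<lambda>w. complex_of_real (Re (X w) * Re (W w) + Im (X w) * Im (W w)))"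
    using assms by (simp only: complex_of_real_integrable_eq Bochner_Integration.integrable_add)
  have i2: "integrable M (\<lambda>w. \<i> * complex_of_real (Im (X w) * Re (W w) - Re (X w) * Im (W w)))"
    using assms by (intro integrable_mult_right) (simp only: complex_of_real_integrable_eq Bochner_Integration.integrable_diff)
  show "integrable M (\<lambda>w. X w * cnj (W w))"
    unfolding eq using i1 i2 by (rule Bochner_Integration.integrable_add)
  have "expectation (\<lambda>w. X w * cnj (W w)) = complex_of_real (a + b) + \<i> * complex_of_real (c - d)"
    unfolding eq Bochner_Integration.integral_add[OF i1 i2] integral_mult_right_zero integral_complex_of_real
    using assms by (simp only: Bochner_Integration.integral_add Bochner_Integration.integral_diff)
  then show "expectation (\<lambda>w. X w * cnj (W w)) = Complex (a + b) (c - d)"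
    by (simp add: complex_eq_iff)
qed

lemma normal_distributed_char:
  assumes "distributed M lborel X (normal_density 0 \<sigma>)" and \<sigma>: "\<sigma> > 0"
  shows "(CLINT w|M. iexp (c * X w)) = complex_of_real (exp (- (c\<^sup>2 * \<sigma>\<^sup>2) / 2))"
proof -
  have D: "distributed M lborel (\<lambda>w. X w / \<sigma>) std_normal_density"
    using assms normal_standard_normal_convert[of \<sigma> X 0] by simp
  have [measurable]: "(\<lambda>w. X w / \<sigma>) \<in> borel_measurable M"
    using distributed_measurable[OF D] by simp
  have "distr M lborel (\<lambda>w. X w / \<sigma>) = std_normal_distribution"
    using distributed_distr_eq_density[OF D] by simp
  then have d: "distr M borel (\<lambda>w. X w / \<sigma>) = std_normal_distribution"
    by (metis distr_cong sets_lborel)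
  have "(CLINT w|M. iexp (c * X w)) = (CLINT w|M. iexp ((c * \<sigma>) * (X w / \<sigma>)))"
    using \<sigma> by (intro Bochner_Integration.integral_cong) auto
  also have "\<dots> = char (distr M borel (\<lambda>w. X w / \<sigma>)) (c * \<sigma>)"
    unfolding char_def by (subst integral_distr) auto
  also have "\<dots> = complex_of_real (exp (- (c\<^sup>2 * \<sigma>\<^sup>2) / 2))"
    unfolding d char_std_normal_distribution by (simp add: power_mult_distrib)
  finally show ?thesis .
qed

text \<open>The orthogonality principle: \<open>orth\<close> makes the error \<open>e\<close>
  uncorrelated with every \<open>x k\<close>, so of the expectation of \<open>e * cnj e\<close> only
  the part paired with \<open>t\<close> survives.\<close>

lemma linear_estimate_mse:
  fixes x :: "nat \<Rightarrow> 'a \<Rightarrow> complex" and t :: "'a \<Rightarrow> complex"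
  assumes xx: "\<And>j k. j < n \<Longrightarrow> k < n \<Longrightarrow> integrable M (\<lambda>w. x j w * cnj (x k w))"
    and tx: "\<And>k. k < n \<Longrightarrow> integrable M (\<lambda>w. t w * cnj (x k w))"
    and tt: "integrable M (\<lambda>w. t w * cnj (t w))"
    and orth: "\<And>k. k < n \<Longrightarrow> (\<Sum>j<n. a j * expectation (\<lambda>w. x j w * cnj (x k w))) = expectation (\<lambda>w. t w * cnj (x k w))"
  shows "integrable M (\<lambda>w. (cmod ((\<Sum>j<n. a j * x j w) - t w))\<^sup>2)"
    and "complex_of_real (expectation (\<lambda>w. (cmod ((\<Sum>j<n. a j * x j w) - t w))\<^sup>2)) =
       expectation (\<lambda>w. t w * cnj (t w)) - (\<Sum>j<n. a j * cnj (expectation (\<lambda>w. t w * cnj (x j w))))"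
proof -
  define e where "e w = (\<Sum>j<n. a j * x j w) - t w" for w
  have xt: "integrable M (\<lambda>w. x j w * cnj (t w))" "expectation (\<lambda>w. x j w * cnj (t w)) = cnj (expectation (\<lambda>w. t w * cnj (x j w)))"
    if "j < n" for j
  proof -
    have eq: "x j w * cnj (t w) = cnj (t w * cnj (x j w))" for w by simp
    show "integrable M (\<lambda>w. x j w * cnj (t w))" unfolding eq using tx[OF that] by (simp only: integrable_cnj)
    show "expectation (\<lambda>w. x j w * cnj (t w)) = cnj (expectation (\<lambda>w. t w * cnj (x j w)))"
      unfolding eq by (rule Bochner_Integration.integral_cnj)
  qed
  have ex: "e w * cnj (x k w) = (\<Sum>j<n. a j * (x j w * cnj (x k w))) - t w * cnj (x k w)" for w k
    by (simp add: e_def algebra_simps sum_distrib_right sum_distrib_left)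
  have et: "e w * cnj (t w) = (\<Sum>j<n. a j * (x j w * cnj (t w))) - t w * cnj (t w)" for w
    by (simp add: e_def algebra_simps sum_distrib_right sum_distrib_left)
  have ex_int: "integrable M (\<lambda>w. e w * cnj (x k w))" if "k < n" for k
    unfolding ex using that xx tx by (intro Bochner_Integration.integrable_diff Bochner_Integration.integrable_sum integrable_mult_right) auto
  have ex_0: "expectation (\<lambda>w. e w * cnj (x k w)) = 0" if "k < n" for k
  proof -
    have "expectation (\<lambda>w. e w * cnj (x k w)) = (\<Sum>j<n. a j * expectation (\<lambda>w. x j w * cnj (x k w))) - expectation (\<lambda>w. t w * cnj (x k w))"
      unfolding ex using that xx tx
      by (subst Bochner_Integration.integral_diff) (auto simp: Bochner_Integration.integral_sum intro!: Bochner_Integration.integrable_sum integrable_mult_right)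
    then show ?thesis using orth[OF that] by simp
  qed
  have et_int: "integrable M (\<lambda>w. e w * cnj (t w))"
    unfolding et using xt tt by (intro Bochner_Integration.integrable_diff Bochner_Integration.integrable_sum integrable_mult_right) auto
  have et_E: "expectation (\<lambda>w. e w * cnj (t w)) = (\<Sum>j<n. a j * cnj (expectation (\<lambda>w. t w * cnj (x j w)))) - expectation (\<lambda>w. t w * cnj (t w))"
    unfolding et using xt tt
    by (subst Bochner_Integration.integral_diff) (auto simp: Bochner_Integration.integral_sum intro!: Bochner_Integration.integrable_sum integrable_mult_right)
  have sq: "complex_of_real ((cmod (e w))\<^sup>2) = (\<Sum>k<n. cnj (a k) * (e w * cnj (x k w))) - e w * cnj (t w)" for w
  proof -
    have "complex_of_real ((cmod (e w))\<^sup>2) = e w * cnj (e w)" by (rule complex_norm_square)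
    also have "cnj (e w) = (\<Sum>k<n. cnj (a k) * cnj (x k w)) - cnj (t w)" by (simp add: e_def)
    finally show ?thesis by (simp add: algebra_simps sum_distrib_left)
  qed
  have "integrable M (\<lambda>w. complex_of_real ((cmod (e w))\<^sup>2))"
    unfolding sq using ex_int et_int by (intro Bochner_Integration.integrable_diff Bochner_Integration.integrable_sum integrable_mult_right) auto
  then show "integrable M (\<lambda>w. (cmod ((\<Sum>j<n. a j * x j w) - t w))\<^sup>2)"
    unfolding complex_of_real_integrable_eq e_def .
  have "complex_of_real (expectation (\<lambda>w. (cmod (e w))\<^sup>2)) = expectation (\<lambda>w. complex_of_real ((cmod (e w))\<^sup>2))"
    by (rule integral_complex_of_real[symmetric])
  also have "\<dots> = (\<Sum>k<n. cnj (a k) * expectation (\<lambda>w. e w * cnj (x k w))) - expectation (\<lambda>w. e w * cnj (t w))"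
    unfolding sq using ex_int et_int
    by (subst Bochner_Integration.integral_diff) (auto simp: Bochner_Integration.integral_sum intro!: Bochner_Integration.integrable_sum integrable_mult_right)
  also have "\<dots> = expectation (\<lambda>w. t w * cnj (t w)) - (\<Sum>j<n. a j * cnj (expectation (\<lambda>w. t w * cnj (x j w))))"
    by (simp add: ex_0 et_E)
  finally show "complex_of_real (expectation (\<lambda>w. (cmod ((\<Sum>j<n. a j * x j w) - t w))\<^sup>2)) =
       expectation (\<lambda>w. t w * cnj (t w)) - (\<Sum>j<n. a j * cnj (expectation (\<lambda>w. t w * cnj (x j w))))"
    unfolding e_def .
qed

end

lemma Re_quant [simp]: "Re (quant z) = sgn1 (Re z) / sqrt 2"
  and Im_quant [simp]: "Im (quant z) = sgn1 (Im z) / sqrt 2"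
  by (simp_all add: quant_def)

lemma quant_mult_cnj [simp]: "quant z * cnj (quant z) = 1"
  by (simp add: complex_eq_iff)

lemma quant_measurable [measurable]: "quant \<in> borel_measurable borel"
  unfolding quant_def by measurable

text \<open>Independence, normality and circularity are packed into one joint characteristic
  function. The 4 in the exponent combines the usual 2 with the fact that real and imaginary parts
  each carry half of the variance \<open>v j\<close>.\<close>

locale circular_family = prob_space M for M :: "'w measure" +
  fixes \<xi> :: "'i \<Rightarrow> 'w \<Rightarrow> complex" and v :: "'i \<Rightarrow> real" and J :: "'i set"
  assumes fin: "finite J" and meas: "\<And>j. j \<in> J \<Longrightarrow> \<xi> j \<in> borel_measurable M"
    and char: "\<And>z. (CLINT w|M. iexp (Re (\<Sum>j\<in>J. z j * \<xi> j w))) =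
       complex_of_real (exp (- (\<Sum>j\<in>J. v j * (cmod (z j))\<^sup>2) / 4))"
begin

definition S where "S z w = (\<Sum>j\<in>J. z j * \<xi> j w)"

text \<open>The Hermitian form that turns out to be the covariance of \<open>S z\<close> and
  \<open>S y\<close>.\<close>

definition ip where "ip z y = (\<Sum>j\<in>J. complex_of_real (v j) * z j * cnj (y j))"

lemma S_measurable [measurable]: "S z \<in> borel_measurable M"
  unfolding S_def using meas by measurable

text \<open>A real combination of real parts is the real part of the combined coefficients, so
  \<open>char\<close> applies, and expanding the squared modulus is polarisation of
  \<open>ip\<close>.\<close>

lemma gauss_pair_Re:
  "gauss_pair M (\<lambda>w. Re (S z w)) (\<lambda>w. Re (S y w)) (Re (ip z z) / 2) (Re (ip y y) / 2) (Re (ip z y) / 2)"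
proof -
  have "(CLINT w|M. iexp (a * Re (S z w) + b * Re (S y w))) =
     complex_of_real (exp (- (a\<^sup>2 * (Re (ip z z) / 2) + 2 * a * b * (Re (ip z y) / 2) + b\<^sup>2 * (Re (ip y y) / 2)) / 2))" for a b
  proof -
    have "a * Re (S z w) + b * Re (S y w) = Re (\<Sum>j\<in>J. (complex_of_real a * z j + complex_of_real b * y j) * \<xi> j w)" for w
      unfolding S_def Re_sum sum_distrib_left sum.distrib[symmetric]
      by (intro sum.cong refl) (simp add: algebra_simps)
    then have "(CLINT w|M. iexp (a * Re (S z w) + b * Re (S y w))) =
       complex_of_real (exp (- (\<Sum>j\<in>J. v j * (cmod (complex_of_real a * z j + complex_of_real b * y j))\<^sup>2) / 4))"
      by (simp only: char)
    also have "(\<Sum>j\<in>J. v j * (cmod (complex_of_real a * z j + complex_of_real b * y j))\<^sup>2) =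
       a\<^sup>2 * Re (ip z z) + 2 * a * b * Re (ip z y) + b\<^sup>2 * Re (ip y y)"
      unfolding ip_def Re_sum sum_distrib_left sum.distrib[symmetric]
      by (intro sum.cong refl) (simp add: cmod_power2, simp add: power2_eq_square algebra_simps)
    also have "- (a\<^sup>2 * Re (ip z z) + 2 * a * b * Re (ip z y) + b\<^sup>2 * Re (ip y y)) / 4 =
       - (a\<^sup>2 * (Re (ip z z) / 2) + 2 * a * b * (Re (ip z y) / 2) + b\<^sup>2 * (Re (ip y y) / 2)) / 2"
      by (simp add: field_simps)
    finally show ?thesis .
  qed
  then show ?thesis unfolding gauss_pair_def by simp
qed

text \<open>Multiplying the coefficients by \<open>- \<i>\<close> exchanges the parts, so every
  combination of real and imaginary parts reduces to \<open>gauss_pair_Re\<close>.\<close>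

lemma Im_S: "Im (S z w) = Re (S (\<lambda>j. - \<i> * z j) w)"
  by (simp add: S_def)

lemma ip_rot:
  "ip (\<lambda>j. - \<i> * z j) y = - \<i> * ip z y" "ip z (\<lambda>j. - \<i> * y j) = \<i> * ip z y"
  by (simp_all add: ip_def sum_distrib_left algebra_simps)

lemma gauss_pair_parts:
  "gauss_pair M (\<lambda>w. Im (S z w)) (\<lambda>w. Im (S y w)) (Re (ip z z) / 2) (Re (ip y y) / 2) (Re (ip z y) / 2)"
  "gauss_pair M (\<lambda>w. Im (S z w)) (\<lambda>w. Re (S y w)) (Re (ip z z) / 2) (Re (ip y y) / 2) (Im (ip z y) / 2)"
  "gauss_pair M (\<lambda>w. Re (S z w)) (\<lambda>w. Im (S y w)) (Re (ip z z) / 2) (Re (ip y y) / 2) (- Im (ip z y) / 2)"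
  using gauss_pair_Re[of "\<lambda>j. - \<i> * z j" "\<lambda>j. - \<i> * y j"] gauss_pair_Re[of "\<lambda>j. - \<i> * z j" y]
    gauss_pair_Re[of z "\<lambda>j. - \<i> * y j"]
  unfolding Im_S[symmetric] ip_rot by simp_all

lemma covariance:
  assumes "Re (ip z z) > 0" "Re (ip y y) > 0"
  shows "integrable M (\<lambda>w. S z w * cnj (S y w))" "expectation (\<lambda>w. S z w * cnj (S y w)) = ip z y"
proof -
  have p: "Re (ip z z) / 2 > 0" "Re (ip y y) / 2 > 0" using assms by auto
  note * = complex_mult_cnj_expectation[OF gauss_pair_covariance[OF gauss_pair_Re[of z y] p]
    gauss_pair_covariance[OF gauss_pair_parts(1)[of z y] p] gauss_pair_covariance[OF gauss_pair_parts(2)[of z y] p]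
    gauss_pair_covariance[OF gauss_pair_parts(3)[of z y] p]]
  show "integrable M (\<lambda>w. S z w * cnj (S y w))" by (rule *(1))
  show "expectation (\<lambda>w. S z w * cnj (S y w)) = ip z y" unfolding *(2) by (simp add: complex_eq_iff)
qed

lemma quant_cross_covariance:
  assumes "Re (ip z z) > 0" "Re (ip y y) > 0"
  shows "integrable M (\<lambda>w. S z w * cnj (quant (S y w)))"
    and "expectation (\<lambda>w. S z w * cnj (quant (S y w))) = complex_of_real (sqrt (2 / (pi * Re (ip y y)))) * ip z y"
proof -
  have p: "Re (ip z z) / 2 > 0" "Re (ip y y) / 2 > 0" using assms by auto
  \<comment> \<open>Bussgang's constant for a part of variance \<open>Re (ip y y) / 2\<close>, the
    normalisation \<open>1 / sqrt 2\<close> of the quantizer, and the halving of the covariance. Two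
    parts contribute equally, so \<open>2 * ?k\<close> is the complex constant.\<close>
  let ?k = "sqrt (2 / (pi * (Re (ip y y) / 2))) / sqrt 2 / 2"
  have G: "integrable M (\<lambda>w. X w * (sgn1 (Y w) / sqrt 2))"
     "expectation (\<lambda>w. X w * (sgn1 (Y w) / sqrt 2)) = ?k * c"
    if "gauss_pair M X Y (Re (ip z z) / 2) (Re (ip y y) / 2) (c / 2)" for X Y c
  proof -
    show "integrable M (\<lambda>w. X w * (sgn1 (Y w) / sqrt 2))"
      using gauss_pair_bussgang(1)[OF that p] by simp
    show "expectation (\<lambda>w. X w * (sgn1 (Y w) / sqrt 2)) = ?k * c"
      unfolding times_divide_eq_right integral_divide_zero gauss_pair_bussgang(2)[OF that p]
      by (simp only: times_divide_eq_left times_divide_eq_right divide_divide_eq_left mult.commute)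
  qed
  note * = complex_mult_cnj_expectation[of "S z" "\<lambda>w. quant (S y w)", unfolded Re_quant Im_quant,
      OF G[OF gauss_pair_Re[of z y]] G[OF gauss_pair_parts(1)[of z y]] G[OF gauss_pair_parts(2)[of z y]]
        G[OF gauss_pair_parts(3)[of z y]]]
  show "integrable M (\<lambda>w. S z w * cnj (quant (S y w)))" by (rule *(1))
  have k: "2 * ?k = sqrt (2 / (pi * Re (ip y y)))"
  proof -
    have "2 / (pi * (Re (ip y y) / 2)) = 2 * (2 / (pi * Re (ip y y)))" by simp
    then show ?thesis by (simp only: real_sqrt_mult) simp
  qed
  show "expectation (\<lambda>w. S z w * cnj (quant (S y w))) = complex_of_real (sqrt (2 / (pi * Re (ip y y)))) * ip z y"
    unfolding *(2) k[symmetric] by (simp only: complex_eq_iff) (simp add: algebra_simps)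
qed

lemma quant_integrable: "integrable M (\<lambda>w. quant (S z w) * cnj (quant (S y w)))"
proof (rule integrable_const_bound[where B=1])
  have "cmod (quant u) = 1" for u
    using complex_norm_square[of "quant u"] norm_ge_zero[of "quant u"] by (simp add: power2_eq_1_iff flip: of_real_power)
  then show "AE w in M. cmod (quant (S z w) * cnj (quant (S y w))) \<le> 1"
    by (simp add: norm_mult)
next
  have [measurable]: "cnj \<in> borel_measurable borel"
    by (intro borel_measurable_continuous_onI linear_continuous_on bounded_linear_cnj)
  show "(\<lambda>w. quant (S z w) * cnj (quant (S y w))) \<in> borel_measurable M" by measurable
qed

text \<open>A real \<open>ip z y\<close> makes mixed real-imaginary pairs uncorrelated, and the
  arcsine law at 0 removes them. The two remaining pairs give \<open>arcsin r / pi\<close>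
  each.\<close>

lemma quant_covariance:
  assumes "ip z z = complex_of_real s" "ip y y = complex_of_real s" "s > 0"
    and "ip z y = complex_of_real (r * s)" "0 \<le> r" "r < 1"
  shows "expectation (\<lambda>w. quant (S z w) * cnj (quant (S y w))) = complex_of_real (2 / pi * arcsin r)"
proof -
  have G: "integrable M (\<lambda>w. sgn1 (X w) / sqrt 2 * (sgn1 (Y w) / sqrt 2))"
     "expectation (\<lambda>w. sgn1 (X w) / sqrt 2 * (sgn1 (Y w) / sqrt 2)) = 1 / pi * arcsin r'"
    if "gauss_pair M X Y (s / 2) (s / 2) (r' * (s / 2))" "0 \<le> r'" "r' < 1" for X Y r'
    using gauss_pair_arcsine[OF that(1) _ that(2,3)] integrable_sgn1_mult[OF gauss_pair_measurable[OF that(1)]] assms(3)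
    by simp_all
  have g: "gauss_pair M (\<lambda>w. Re (S z w)) (\<lambda>w. Re (S y w)) (s / 2) (s / 2) (r * (s / 2))"
    "gauss_pair M (\<lambda>w. Im (S z w)) (\<lambda>w. Im (S y w)) (s / 2) (s / 2) (r * (s / 2))"
    "gauss_pair M (\<lambda>w. Im (S z w)) (\<lambda>w. Re (S y w)) (s / 2) (s / 2) (0 * (s / 2))"
    "gauss_pair M (\<lambda>w. Re (S z w)) (\<lambda>w. Im (S y w)) (s / 2) (s / 2) (0 * (s / 2))"
    using gauss_pair_Re[of z y] gauss_pair_parts[of z y] unfolding assms by simp_all
  have z: "(0::real) \<le> 0" "(0::real) < 1" by simp_all
  note * = complex_mult_cnj_expectation(2)[of "\<lambda>w. quant (S z w)" "\<lambda>w. quant (S y w)", unfolded Re_quant Im_quant,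
      OF G[OF g(1) assms(5,6)] G[OF g(2) assms(5,6)] G[OF g(3) z] G[OF g(4) z]]
  show ?thesis unfolding * by (simp add: complex_eq_iff)
qed

end

section \<open>The observation model\<close>

text \<open>Complex counterpart of \<open>comp_index\<close>: one pair \<open>(k, i)\<close> stands
  for both real components of a source.\<close>

definition source_index :: "nat \<Rightarrow> nat \<Rightarrow> nat \<Rightarrow> (nat \<times> nat) set" where
  "source_index m Na Nq = (SIGMA k:{..<3}. {..<if k = 0 then m else if k = 1 then Na else Nq})"

definition source :: "('w \<Rightarrow> nat \<Rightarrow> complex) \<Rightarrow> ('w \<Rightarrow> nat \<Rightarrow> complex) \<Rightarrow> ('w \<Rightarrow> nat \<Rightarrow> complex)
    \<Rightarrow> nat \<times> nat \<Rightarrow> 'w \<Rightarrow> complex" where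
  "source th wa wq = (\<lambda>(k, i) \<omega>. if k = 0 then th \<omega> i else if k = 1 then wa \<omega> i else wq \<omega> i)"

lemma finite_source_index: "finite (source_index m Na Nq)"
  by (simp add: source_index_def)

lemma sum_source_index:
  "(\<Sum>j\<in>source_index m Na Nq. f j) = (\<Sum>l<m. f (0, l)) + (\<Sum>l<Na. f (1, l)) + (\<Sum>l<Nq. f (2, l))"
proof -
  have "(\<Sum>j\<in>source_index m Na Nq. f j) = (\<Sum>k<3. \<Sum>l<(if k = 0 then m else if k = 1 then Na else Nq). f (k, l))"
    unfolding source_index_def by (subst sum.Sigma) auto
  then show ?thesis by (simp add: numeral_3_eq_3 numeral_2_eq_2)
qed

lemma sum_comp_index:
  "(\<Sum>n\<in>comp_index m Na Nq. f n) = (\<Sum>(k, i)\<in>source_index m Na Nq. f (k, True, i) + f (k, False, i))"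
proof -
  have eq: "comp_index m Na Nq = (\<lambda>((k, i), b). (k, b, i)) ` (source_index m Na Nq \<times> UNIV)"
    by (auto simp: comp_index_def source_index_def image_iff split: if_splits)
  have "(\<Sum>n\<in>comp_index m Na Nq. f n) = (\<Sum>((k, i), b)\<in>source_index m Na Nq \<times> UNIV. f (k, b, i))"
    unfolding eq by (subst sum.reindex) (auto simp: inj_on_def case_prod_beta intro!: sum.cong)
  also have "\<dots> = (\<Sum>j\<in>source_index m Na Nq. \<Sum>b\<in>UNIV. case (j, b) of ((k, i), b) \<Rightarrow> f (k, b, i))"
    by (subst sum.cartesian_product) (auto intro!: sum.cong)
  finally show ?thesis by (simp add: UNIV_bool case_prod_beta add.commute)
qed

text \<open>The real part of a complex combination is a real combination of independent real
  Gaussians, so its characteristic function is a product, and the two factors of each source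
  recombine into the squared modulus of its coefficient.\<close>

lemma (in prob_space) source_circular_family:
  assumes sa: "sa2 > 0" and sq: "sq2 > 0"
    and indep: "indep_vars (\<lambda>_. borel) (scalar_comps th wa wq) (comp_index m Na Nq)"
    and gauss: "\<And>k b i. (k, b, i) \<in> comp_index m Na Nq \<Longrightarrow>
        distributed M lborel (scalar_comps th wa wq (k, b, i)) (normal_density 0 (sqrt (block_var sa2 sq2 k / 2)))"
  shows "circular_family M (source th wa wq) (\<lambda>(k, i). block_var sa2 sq2 k) (source_index m Na Nq)"
proof
  let ?I = "comp_index m Na Nq" and ?J = "source_index m Na Nq" and ?X = "scalar_comps th wa wq"
  show "finite ?J" by (rule finite_source_index)
  have X_re: "?X (k, True, i) w = Re (source th wa wq (k, i) w)" and X_im: "?X (k, False, i) w = Im (source th wa wq (k, i) w)" for k i w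
    by (simp_all add: scalar_comps_def source_def)
  have XI: "(k, b, i) \<in> ?I" if "(k, i) \<in> ?J" for k b i
    using that by (auto simp: comp_index_def source_index_def split: if_splits)
  have rv: "?X n \<in> borel_measurable M" if "n \<in> ?I" for n
    using indep that by (auto simp: indep_vars_def)
  show "source th wa wq j \<in> borel_measurable M" if "j \<in> ?J" for j
  proof -
    obtain k i where j: "j = (k, i)" by (cases j)
    have [measurable]: "?X (k, True, i) \<in> borel_measurable M" "?X (k, False, i) \<in> borel_measurable M"
      using that XI rv unfolding j by blast+
    have "source th wa wq (k, i) w = complex_of_real (?X (k, True, i) w) + \<i> * complex_of_real (?X (k, False, i) w)" for w
      unfolding X_re X_im by (rule complex_eq)
    then have "source th wa wq (k, i) = (\<lambda>w. complex_of_real (?X (k, True, i) w) + \<i> * complex_of_real (?X (k, False, i) w))"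
      by (rule ext)
    also have "\<dots> \<in> borel_measurable M" by measurable
    finally show ?thesis unfolding j .
  qed
  fix z :: "nat \<times> nat \<Rightarrow> complex"
  \<comment> \<open>The minus sign is that of the product of imaginary parts in the real part of a
    complex product.\<close>
  define c where "c = (\<lambda>(k, b, i). if b then Re (z (k, i)) else - Im (z (k, i)))"
  let ?v = "\<lambda>(k, b, i). block_var sa2 sq2 k"
  have vpos: "block_var sa2 sq2 k > 0" for k using sa sq by (simp add: block_var_def)
  have "Re (\<Sum>j\<in>?J. z j * source th wa wq j w) = (\<Sum>n\<in>?I. c n * ?X n w)" for w
    unfolding sum_comp_index Re_sum
    by (intro sum.cong refl) (auto simp: c_def X_re X_im)
  then have "(CLINT w|M. iexp (Re (\<Sum>j\<in>?J. z j * source th wa wq j w))) = (CLINT w|M. iexp (1 * (\<Sum>n\<in>?I. c n * ?X n w)))"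
    by (simp only: mult_1)
  also have "\<dots> = char (distr M borel (\<lambda>w. \<Sum>n\<in>?I. c n * ?X n w)) 1"
    unfolding char_def using rv by (subst integral_distr) auto
  also have "\<dots> = (\<Prod>n\<in>?I. char (distr M borel (\<lambda>w. c n * ?X n w)) 1)"
    by (rule char_distr_sum, rule indep_vars_compose2[OF indep]) simp
  also have "\<dots> = (\<Prod>n\<in>?I. complex_of_real (exp (- (c n)\<^sup>2 * ?v n / 4)))"
  proof (rule prod.cong[OF refl])
    fix n assume n: "n \<in> ?I"
    obtain k b i where nn: "n = (k, b, i)" by (cases n)
    have "char (distr M borel (\<lambda>w. c n * ?X n w)) 1 = (CLINT w|M. iexp (1 * (c n * ?X n w)))"
      unfolding char_def using rv[OF n] by (subst integral_distr) auto
    also have "\<dots> = (CLINT w|M. iexp (c n * ?X n w))" by (simp only: mult_1)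
    also have "\<dots> = complex_of_real (exp (- ((c n)\<^sup>2 * (sqrt (block_var sa2 sq2 k / 2))\<^sup>2) / 2))"
      unfolding nn by (rule normal_distributed_char[OF gauss]) (use n vpos nn in auto)
    also have "\<dots> = complex_of_real (exp (- (c n)\<^sup>2 * ?v n / 4))"
      unfolding nn using vpos[of k] by simp
    finally show "char (distr M borel (\<lambda>w. c n * ?X n w)) 1 = complex_of_real (exp (- (c n)\<^sup>2 * ?v n / 4))" .
  qed
  also have "\<dots> = complex_of_real (exp (\<Sum>n\<in>?I. - (c n)\<^sup>2 * ?v n / 4))"
  proof -
    have "finite ?I"
      by (rule finite_subset[of _ "{..2} \<times> UNIV \<times> {..<max m (max Na Nq)}"]) (auto simp: comp_index_def)
    then show ?thesis by (simp add: exp_sum)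
  qed
  also have "(\<Sum>n\<in>?I. - (c n)\<^sup>2 * ?v n / 4) = - (\<Sum>j\<in>?J. (case j of (k, i) \<Rightarrow> block_var sa2 sq2 k) * (cmod (z j))\<^sup>2) / 4"
    unfolding sum_comp_index sum_negf[symmetric] sum_divide_distrib
    by (intro sum.cong refl) (auto simp: c_def cmod_power2 field_simps)
  finally show "(CLINT w|M. iexp (Re (\<Sum>j\<in>?J. z j * source th wa wq j w))) =
     complex_of_real (exp (- (\<Sum>j\<in>?J. (case j of (k, i) \<Rightarrow> block_var sa2 sq2 k) * (cmod (z j))\<^sup>2) / 4))" .
qed

text \<open>Lets one Gram computation for stacked blocks serve both \<open>H\<close> and
  \<open>G\<close>.\<close>

lemma kron_ones_eq_stack_blocks: "kron_ones m n B = stack_blocks m n (\<lambda>_. B)"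
  by (simp add: kron_ones_def stack_blocks_def)

lemma stack_blocks_carrier: "stack_blocks m n B \<in> carrier_mat (m * n) m"
  by (simp add: stack_blocks_def)

lemma sum_div_mod:
  fixes f :: "nat \<Rightarrow> nat \<Rightarrow> 'b :: comm_monoid_add"
  shows "(\<Sum>r<m * n. f (r div m) (r mod m)) = (\<Sum>b<n. \<Sum>l<m. f b l)"
proof -
  have "(\<Sum>r<m * n. f (r div m) (r mod m)) = (\<Sum>b<n. \<Sum>l<m. f ((l + b * m) div m) ((l + b * m) mod m))"
    unfolding mult.commute[of m n] by (rule sum_mult_product)
  then show ?thesis by simp
qed

text \<open>Splitting the row index into block and offset shows that the Gram matrix of a stack is
  the sum of the Gram matrices of its blocks; mixed products of different blocks do not
  appear.\<close>

lemma adjoint_stack_blocks_mult: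
  assumes B: "\<And>i. i < n \<Longrightarrow> B i \<in> carrier_mat m m \<and> mat_adjoint (B i) * B i = c \<cdot>\<^sub>m 1\<^sub>m m"
  shows "mat_adjoint (stack_blocks m n B) * stack_blocks m n B = (of_nat n * c) \<cdot>\<^sub>m 1\<^sub>m m"
proof (rule eq_matI)
  fix i j assume "i < dim_row ((of_nat n * c) \<cdot>\<^sub>m 1\<^sub>m m :: complex mat)" "j < dim_col ((of_nat n * c) \<cdot>\<^sub>m 1\<^sub>m m :: complex mat)"
  then have i: "i < m" and j: "j < m" by simp_all
  note d = carrier_matD[OF stack_blocks_carrier[of m n B]]
  have "(mat_adjoint (stack_blocks m n B) * stack_blocks m n B) $$ (i, j) =
     (\<Sum>r<m * n. cnj (B (r div m) $$ (r mod m, i)) * B (r div m) $$ (r mod m, j))"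
    using i j by (auto simp: d scalar_prod_def stack_blocks_def lessThan_atLeast0 intro!: sum.cong)
  also have "\<dots> = (\<Sum>b<n. \<Sum>l<m. cnj (B b $$ (l, i)) * B b $$ (l, j))"
    by (rule sum_div_mod)
  also have "\<dots> = (\<Sum>b<n. c * (if i = j then 1 else 0))"
  proof (rule sum.cong[OF refl])
    fix b assume "b \<in> {..<n}"
    then have b: "B b \<in> carrier_mat m m" "mat_adjoint (B b) * B b = c \<cdot>\<^sub>m 1\<^sub>m m" using B by auto
    have "(\<Sum>l<m. cnj (B b $$ (l, i)) * B b $$ (l, j)) = (mat_adjoint (B b) * B b) $$ (i, j)"
      using i j carrier_matD[OF b(1)] by (auto simp: scalar_prod_def lessThan_atLeast0 intro!: sum.cong)
    also have "\<dots> = c * (if i = j then 1 else 0)" unfolding b(2) using i j by simp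
    finally show "(\<Sum>l<m. cnj (B b $$ (l, i)) * B b $$ (l, j)) = c * (if i = j then 1 else 0)" .
  qed
  finally show "(mat_adjoint (stack_blocks m n B) * stack_blocks m n B) $$ (i, j) = ((of_nat n * c) \<cdot>\<^sub>m 1\<^sub>m m) $$ (i, j)"
    using i j by simp
qed (simp_all add: stack_blocks_def)

text \<open>For a square matrix the left inverse, the adjoint divided by \<open>\<rho>\<close>, is
  also a right inverse. The model constrains the columns, whereas the arcsine law is applied to
  correlations between rows.\<close>

lemma unitary_rows:
  assumes G: "G \<in> carrier_mat m m" and GG: "mat_adjoint G * G = complex_of_real \<rho> \<cdot>\<^sub>m 1\<^sub>m m" and \<rho>: "\<rho> > 0"
    and ij: "i < m" "j < m"
  shows "(\<Sum>l<m. G $$ (i, l) * cnj (G $$ (j, l))) = (if i = j then complex_of_real \<rho> else 0)"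
proof -
  let ?c = "complex_of_real \<rho>"
  have aG: "mat_adjoint G \<in> carrier_mat m m" using G by simp
  have "((1 / ?c) \<cdot>\<^sub>m mat_adjoint G) * G = (1 / ?c) \<cdot>\<^sub>m (?c \<cdot>\<^sub>m 1\<^sub>m m)"
    unfolding GG[symmetric] by (rule mult_smult_assoc_mat[OF aG G])
  also have "\<dots> = 1\<^sub>m m" using \<rho> by (intro eq_matI) auto
  finally have "G * ((1 / ?c) \<cdot>\<^sub>m mat_adjoint G) = 1\<^sub>m m"
    using mat_mult_left_right_inverse[OF smult_carrier_mat[OF aG] G] by simp
  then have "(1 / ?c) \<cdot>\<^sub>m (G * mat_adjoint G) = 1\<^sub>m m"
    by (simp only: mult_smult_distrib[OF G aG])
  then have "((1 / ?c) \<cdot>\<^sub>m (G * mat_adjoint G)) $$ (i, j) = (1\<^sub>m m :: complex mat) $$ (i, j)" by simp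
  then have "(G * mat_adjoint G) $$ (i, j) / ?c = (if i = j then 1 else 0)"
    using ij carrier_matD[OF G] by simp
  then have "(G * mat_adjoint G) $$ (i, j) = (if i = j then ?c else 0)"
    using \<rho> by (auto simp: field_simps split: if_splits)
  moreover have "(G * mat_adjoint G) $$ (i, j) = (\<Sum>l<m. G $$ (i, l) * cnj (G $$ (j, l)))"
    using ij carrier_matD[OF G] by (auto simp: scalar_prod_def lessThan_atLeast0 intro!: sum.cong)
  ultimately show ?thesis by simp
qed

text \<open>This is \<open>sin y \<le> y\<close> at \<open>y = arcsin x\<close>.\<close>

lemma arcsin_ge_self:
  assumes "0 \<le> x" "x \<le> 1"
  shows "x \<le> arcsin x"
  using sin_x_le_x[of "arcsin x"] arcsin_le_arcsin[of 0 x] assms by simp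

text \<open>Block 0 of the sources is \<open>\<theta>\<close>, blocks 1 and 2 are the noise vectors; any other \<open>k0\<close> stands for a noiseless observation.\<close>

definition obs_coeff :: "(nat \<Rightarrow> complex) \<Rightarrow> nat \<Rightarrow> nat \<Rightarrow> nat \<times> nat \<Rightarrow> complex" where
  "obs_coeff h k0 i = (\<lambda>(k, l). if k = 0 then h l else if k = k0 \<and> l = i then 1 else 0)"

text \<open>Invertibility of the covariance is part of the conclusion, because the estimator formula
  in \<open>lmmse\<close> presupposes it.\<close>

theorem theorem1:
  fixes P :: "'w measure"
    and M na nq :: nat
    and th wa wq :: "'w \<Rightarrow> nat \<Rightarrow> complex"
    and Hb :: "nat \<Rightarrow> complex mat" and G1 :: "complex mat"
    and \<rho>a \<rho>q sa2 sq2 :: real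
  assumes "prob_space P"
    and "M \<ge> 1"
    and "\<rho>a > 0" "\<rho>q > 0" "sa2 > 0" "sq2 > 0"
    and Hb: "\<And>i. i < na \<Longrightarrow> Hb i \<in> carrier_mat M M \<and>
                   mat_adjoint (Hb i) * Hb i = complex_of_real \<rho>a \<cdot>\<^sub>m 1\<^sub>m M"
    and G1: "G1 \<in> carrier_mat M M" "mat_adjoint G1 * G1 = complex_of_real \<rho>q \<cdot>\<^sub>m 1\<^sub>m M"
    and indep: "prob_space.indep_vars P (\<lambda>_. borel) (scalar_comps th wa wq) (comp_index M (M * na) (M * nq))"
    and gauss: "\<And>k b i. (k, b, i) \<in> comp_index M (M * na) (M * nq) \<Longrightarrow>
        distributed P lborel (scalar_comps th wa wq (k, b, i))
           (normal_density 0 (sqrt (block_var sa2 sq2 k / 2)))"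
  defines "xa \<equiv> (\<lambda>\<omega>. stack_blocks M na Hb *\<^sub>v rvec M th \<omega> + rvec (M * na) wa \<omega>)"
    and "xq \<equiv> (\<lambda>\<omega>. quant_vec (kron_ones M nq G1 *\<^sub>v rvec M th \<omega> + rvec (M * nq) wq \<omega>))"
    and "D \<equiv> alpha_c \<rho>q sq2 + beta_c \<rho>a \<rho>q sa2 sq2 na * \<rho>q * real nq"
  shows "invertible_mat (cross_cov P (M * na + M * nq) (M * na + M * nq)
                           (\<lambda>\<omega>. vstack (xa \<omega>) (xq \<omega>)) (\<lambda>\<omega>. vstack (xa \<omega>) (xq \<omega>)))
    \<and> (\<forall>\<omega>. lmmse P M (M * na + M * nq) (rvec M th) (\<lambda>\<omega>. vstack (xa \<omega>) (xq \<omega>)) \<omega>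
            = complex_of_real (1 / (\<rho>a * real na + sa2)
                 - 2 * \<rho>q * real nq * sa2 / (pi * (\<rho>q + sq2) * D * (\<rho>a * real na + sa2)^2))
                \<cdot>\<^sub>v (mat_adjoint (stack_blocks M na Hb) *\<^sub>v xa \<omega>)
              + complex_of_real (sqrt (2 / (pi * (\<rho>q + sq2))) * sa2 / (D * (\<rho>a * real na + sa2)))
                \<cdot>\<^sub>v (mat_adjoint (kron_ones M nq G1) *\<^sub>v xq \<omega>))
    \<and> integral\<^sup>L P (\<lambda>\<omega>. \<Sum>i<M. (cmod (lmmse P M (M * na + M * nq) (rvec M th)
                                    (\<lambda>\<omega>. vstack (xa \<omega>) (xq \<omega>)) \<omega> $ i - th \<omega> i))^2)
        = real M - real M * (\<rho>a * real na / (\<rho>a * real na + sa2)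
            + 2 * \<rho>q * real nq * sa2^2 / (pi * (\<rho>q + sq2) * D * (\<rho>a * real na + sa2)^2))"
proof -
  interpret prob_space P by fact
  note pos = \<open>\<rho>a > 0\<close> \<open>\<rho>q > 0\<close> \<open>sa2 > 0\<close> \<open>sq2 > 0\<close>

  \<comment> \<open>Constants, positivity and the two models\<close>
  define p q where "p = M * na" and "q = M * nq"
  interpret CF: circular_family P "source th wa wq" "\<lambda>(k, i). block_var sa2 sq2 k" "source_index M p q"
    using source_circular_family[OF pos(3,4) indep gauss] unfolding p_def q_def .
  define H where "H = stack_blocks M na Hb"
  define G where "G = kron_ones M nq G1"
  define A B r \<kappa> \<alpha> \<gamma> where "A = \<rho>a * real na" and "B = \<rho>q * real nq" and "r = \<rho>q / (\<rho>q + sq2)"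
    and "\<kappa> = sqrt (2 / (pi * (\<rho>q + sq2)))" and "\<alpha> = alpha_c \<rho>q sq2" and "\<gamma> = 2 / pi * arcsin r * (1 / \<rho>q)"
  have r: "0 \<le> r" "r < 1" using pos by (auto simp: r_def)
  have A0: "A \<ge> 0" and B0: "B \<ge> 0" and As: "A + sa2 > 0" using pos by (auto simp: A_def B_def intro: add_nonneg_pos)
  have \<kappa>2: "\<kappa>\<^sup>2 = 2 / (pi * (\<rho>q + sq2))" using pos by (simp add: \<kappa>_def)
  have \<alpha>_eq: "\<alpha> = 1 - 2 / pi * arcsin r" by (simp add: \<alpha>_def alpha_c_def r_def)
  \<comment> \<open>\<open>arcsin 1 = pi / 2\<close>, so \<alpha> is positive exactly because noise
    keeps \<open>r\<close> below 1.\<close>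
  have "arcsin r < arcsin 1" using r by (intro arcsin_less_arcsin) auto
  then have \<alpha>0: "\<alpha> > 0" by (simp add: \<alpha>_eq field_simps)
  have D_eq: "D = \<alpha> + (\<gamma> - \<kappa>\<^sup>2 * A / (A + sa2)) * B"
    by (simp add: D_def \<kappa>2 \<alpha>_def \<gamma>_def beta_c_def A_def B_def r_def)
  have D0: "D > 0"
  proof -
    \<comment> \<open>\<open>\<kappa>\<^sup>2\<close> is \<gamma> with \<open>arcsin r\<close>
      replaced by \<open>r\<close>, which makes the comparison an instance of
      \<open>arcsin_ge_self\<close>.\<close>
    have "\<kappa>\<^sup>2 = 2 / pi * r * (1 / \<rho>q)" using pos by (simp add: \<kappa>2 r_def)
    also have "\<dots> \<le> \<gamma>" unfolding \<gamma>_def using arcsin_ge_self[of r] r pos by (intro mult_right_mono mult_left_mono) auto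
    finally have "\<kappa>\<^sup>2 \<le> \<gamma>" .
    moreover have "\<kappa>\<^sup>2 * A / (A + sa2) \<le> \<kappa>\<^sup>2"
    proof -
      have "\<kappa>\<^sup>2 * (A / (A + sa2)) \<le> \<kappa>\<^sup>2 * 1" using As pos by (intro mult_left_mono) auto
      then show ?thesis by simp
    qed
    ultimately have "(\<gamma> - \<kappa>\<^sup>2 * A / (A + sa2)) * B \<ge> 0" using B0 by (intro mult_nonneg_nonneg) auto
    then show ?thesis using \<alpha>0 by (simp add: D_eq)
  qed
  have H: "H \<in> carrier_mat p M" unfolding H_def p_def by (rule stack_blocks_carrier)
  have G: "G \<in> carrier_mat q M" unfolding G_def q_def kron_ones_eq_stack_blocks by (rule stack_blocks_carrier)
  note Hd = carrier_matD[OF H] and Gd = carrier_matD[OF G]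
  have cD: "complex_of_real \<alpha> + (complex_of_real \<gamma> - (complex_of_real \<kappa>)\<^sup>2 * complex_of_real A / (complex_of_real A + complex_of_real sa2)) * complex_of_real B = complex_of_real D"
    unfolding D_eq by simp
  interpret BM: two_block_model H G M p q "complex_of_real A" "complex_of_real B" "complex_of_real sa2"
    "complex_of_real \<kappa>" "complex_of_real \<alpha>" "complex_of_real \<gamma>"
  proof
    show "mat_adjoint H * H = complex_of_real A \<cdot>\<^sub>m 1\<^sub>m M"
      using adjoint_stack_blocks_mult[of na Hb M "complex_of_real \<rho>a"] Hb by (simp add: H_def A_def mult.commute)
    show "mat_adjoint G * G = complex_of_real B \<cdot>\<^sub>m 1\<^sub>m M"
      using adjoint_stack_blocks_mult[of nq "\<lambda>_. G1" M "complex_of_real \<rho>q"] G1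
      by (simp add: G_def B_def kron_ones_eq_stack_blocks mult.commute)
    show "complex_of_real A + complex_of_real sa2 \<noteq> 0"
      using As by (simp flip: of_real_add)
    show "complex_of_real \<alpha> + (complex_of_real \<gamma> - (complex_of_real \<kappa>)\<^sup>2 * complex_of_real A / (complex_of_real A + complex_of_real sa2)) * complex_of_real B \<noteq> 0"
      unfolding cD using D0 by simp
  qed (use H G pos \<alpha>0 in auto)

  \<comment> \<open>Parameter and observations as combinations of the sources\<close>
  define zt za zq where "zt i = obs_coeff (\<lambda>l. if l = i then 1 else 0) 3 0"
    and "za i = obs_coeff (\<lambda>l. H $$ (i, l)) 1 i" and "zq i = obs_coeff (\<lambda>l. G $$ (i, l)) 2 i" for i
  have S_obs: "CF.S (obs_coeff h k0 i) w = (\<Sum>l<M. h l * th w l) +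
     (if k0 = 1 \<and> i < p then wa w i else if k0 = 2 \<and> i < q then wq w i else 0)" for h k0 i w
  proof -
    have n: "(\<Sum>l<n. (if k = k0 \<and> l = i then 1 else 0) * f l) = (if k0 = k \<and> i < n then f i else 0)"
      for n and k :: nat and f :: "nat \<Rightarrow> complex"
    proof -
      have "(\<Sum>l<n. (if k = k0 \<and> l = i then 1 else 0) * f l) = (\<Sum>l<n. if l = i then (if k0 = k then f l else 0) else 0)"
        by (intro sum.cong) auto
      then show ?thesis by (simp add: sum.delta)
    qed
    show ?thesis
      unfolding CF.S_def sum_source_index
      using n[of 1 "\<lambda>l. wa w l" p] n[of 2 "\<lambda>l. wq w l" q] by (simp add: obs_coeff_def source_def)
  qed
  have ip_obs: "CF.ip (obs_coeff h k0 i) (obs_coeff h' k1 j) = (\<Sum>l<M. h l * cnj (h' l)) +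
     (if k0 = k1 \<and> i = j then if k0 = 1 \<and> i < p then complex_of_real sa2 else if k0 = 2 \<and> i < q then complex_of_real sq2 else 0 else 0)" for h k0 i h' k1 j
  proof -
    have n: "(\<Sum>l<n. complex_of_real c * (if k = k0 \<and> l = i then 1 else 0) * cnj (if k = k1 \<and> l = j then 1 else 0)) =
       (if k0 = k \<and> k1 = k \<and> i = j \<and> i < n then complex_of_real c else 0)" for n c and k :: nat
    proof -
      have "(\<Sum>l<n. complex_of_real c * (if k = k0 \<and> l = i then 1 else 0) * cnj (if k = k1 \<and> l = j then 1 else 0)) =
         (\<Sum>l<n. if l = i then (if k0 = k \<and> k1 = k \<and> i = j then complex_of_real c else 0) else 0)"
        by (intro sum.cong) auto
      then show ?thesis by (simp add: sum.delta)
    qed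
    show ?thesis
      unfolding CF.ip_def sum_source_index
      using n[of sa2 1 p] n[of sq2 2 q] by (simp add: obs_coeff_def block_var_def)
  qed
  have ip_tt: "CF.ip (zt i) (zt i) = 1" if "i < M" for i
  proof -
    have "(\<Sum>l<M. (if l = i then 1 else 0) * cnj (if l = i then 1 else 0)) = (\<Sum>l<M. if l = i then 1 else 0 :: complex)"
      by (intro sum.cong) auto
    then show ?thesis unfolding zt_def ip_obs using that by simp
  qed
  have delta: "(\<Sum>l<M. (if l = i then 1 else 0) * f l) = f i" if "i < M" for i and f :: "nat \<Rightarrow> complex"
    using that by (simp add: if_distrib[of "\<lambda>x. x * _"] cong: if_cong)
  have ip_ta: "CF.ip (zt i) (za j) = cnj (H $$ (j, i))" and ip_tq: "CF.ip (zt i) (zq j) = cnj (G $$ (j, i))" if "i < M" for i j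
    unfolding zt_def za_def zq_def ip_obs using delta[OF that] by simp_all
  have ip_aa: "CF.ip (za i) (za j) = (\<Sum>l<M. H $$ (i, l) * cnj (H $$ (j, l))) + (if i = j then complex_of_real sa2 else 0)"
    if "i < p" for i j
    unfolding za_def ip_obs using that by simp
  have ip_aq: "CF.ip (za i) (zq j) = (\<Sum>l<M. H $$ (i, l) * cnj (G $$ (j, l)))" for i j
    unfolding za_def zq_def ip_obs by simp
  have M0: "M > 0" using \<open>M \<ge> 1\<close> by simp
  \<comment> \<open>Row \<open>i\<close> of \<open>G\<close> is row \<open>i mod M\<close> of
    \<open>G1\<close>: repeated rows are parallel, all others orthogonal.\<close>
  have GG: "(\<Sum>l<M. G $$ (i, l) * cnj (G $$ (j, l))) = (if i mod M = j mod M then complex_of_real \<rho>q else 0)"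
    if "i < q" "j < q" for i j
  proof -
    have "(\<Sum>l<M. G $$ (i, l) * cnj (G $$ (j, l))) = (\<Sum>l<M. G1 $$ (i mod M, l) * cnj (G1 $$ (j mod M, l)))"
      using that by (simp add: G_def kron_ones_def q_def)
    also have "\<dots> = (if i mod M = j mod M then complex_of_real \<rho>q else 0)"
      using unitary_rows[OF G1 pos(2)] M0 by simp
    finally show ?thesis .
  qed
  have ip_qq: "CF.ip (zq i) (zq j) = (if i = j then complex_of_real (\<rho>q + sq2) else if i mod M = j mod M then complex_of_real \<rho>q else 0)"
    if "i < q" "j < q" for i j
    unfolding zq_def ip_obs using GG[OF that] that by simp
  have pos_t: "Re (CF.ip (zt i) (zt i)) > 0" if "i < M" for i using ip_tt[OF that] by simp
  have pos_q: "Re (CF.ip (zq i) (zq i)) > 0" if "i < q" for i using ip_qq[OF that that] pos by simp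
  have pos_a: "Re (CF.ip (za i) (za i)) > 0" if "i < p" for i
  proof -
    have "Re (\<Sum>l<M. H $$ (i, l) * cnj (H $$ (i, l))) \<ge> 0"
      unfolding Re_sum by (intro sum_nonneg) simp
    then show ?thesis unfolding ip_aa[OF that] using pos by simp
  qed
  have \<kappa>_q: "sqrt (2 / (pi * Re (CF.ip (zq i) (zq i)))) = \<kappa>" if "i < q" for i
    using ip_qq[OF that that] by (simp add: \<kappa>_def)

  \<comment> \<open>The observation vector inside the circular family\<close>
  define x where "x j w = (if j < p then CF.S (za j) w else quant (CF.S (zq (j - p)) w))" for j w
  have S_t: "CF.S (zt i) w = th w i" if "i < M" for i w
    unfolding zt_def S_obs using delta[OF that] by simp
  have xa_eq: "xa = (\<lambda>w. H *\<^sub>v rvec M th w + rvec p wa w)"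
    unfolding xa_def H_def p_def ..
  have xq_eq: "xq = (\<lambda>w. quant_vec (G *\<^sub>v rvec M th w + rvec q wq w))"
    unfolding xq_def G_def q_def ..
  have xa_c: "xa w \<in> carrier_vec p" and xq_c: "xq w \<in> carrier_vec q" for w
    by (intro carrier_vecI; simp add: xa_eq xq_eq quant_vec_def rvec_def)+
  have mv: "(Y *\<^sub>v rvec M th w) $ i = (\<Sum>l<M. Y $$ (i, l) * th w l)" if "Y \<in> carrier_mat n M" "i < n" for Y n i w
    using that(2) carrier_matD[OF that(1)] by (simp add: scalar_prod_def rvec_def lessThan_atLeast0)
  have xa_i: "xa w $ i = CF.S (za i) w" if "i < p" for i w
    using that mv[OF H that] unfolding za_def S_obs by (simp add: xa_eq rvec_def del: index_mult_mat_vec)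
  have xq_i: "xq w $ i = quant (CF.S (zq i) w)" if "i < q" for i w
    using that mv[OF G that] carrier_matD[OF G] unfolding zq_def S_obs
    by (simp add: xq_eq quant_vec_def rvec_def del: index_mult_mat_vec)
  have vst: "vstack (xa w) (xq w) = xa w @\<^sub>v xq w" for w
    by (simp add: vstack_def append_vec_def Let_def)
  let ?x = "\<lambda>w. vstack (xa w) (xq w)"
  have x_i: "?x w $ j = x j w" if "j < p + q" for j w
    unfolding vst x_def using that carrier_vecD[OF xa_c] carrier_vecD[OF xq_c] by (auto simp: xa_i xq_i)

  \<comment> \<open>Covariance of the observation\<close>
  have xx_int: "integrable P (\<lambda>w. x i w * cnj (x j w))" and
    xx_E: "expectation (\<lambda>w. x i w * cnj (x j w)) = BM.C $$ (i, j)" if ij: "i < p + q" "j < p + q" for i j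
  proof -
    consider (aa) "i < p" "j < p" | (aq) "i < p" "\<not> j < p" | (qa) "\<not> i < p" "j < p" | (qq) "\<not> i < p" "\<not> j < p" by blast
    then have "integrable P (\<lambda>w. x i w * cnj (x j w)) \<and> expectation (\<lambda>w. x i w * cnj (x j w)) = BM.C $$ (i, j)"
    proof cases
      case aa
      have "BM.C $$ (i, j) = CF.ip (za i) (za j)"
        using aa Hd Gd ip_aa[of i j] by (auto simp: BM.C_def scalar_prod_def lessThan_atLeast0 intro!: sum.cong)
      then show ?thesis using CF.covariance[OF pos_a pos_a, of i j] aa by (simp add: x_def)
    next
      case aq
      then have j: "j - p < q" using ij by auto
      have "BM.C $$ (i, j) = complex_of_real \<kappa> * CF.ip (za i) (zq (j - p))"
        using aq j Hd Gd by (auto simp: BM.C_def ip_aq scalar_prod_def lessThan_atLeast0 intro!: sum.cong)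
      then show ?thesis using CF.quant_cross_covariance[OF pos_a pos_q, of i "j - p"] aq j \<kappa>_q[OF j] by (simp add: x_def)
    next
      case qa
      then have i: "i - p < q" using ij by auto
      have eq: "x i w * cnj (x j w) = cnj (CF.S (za j) w * cnj (quant (CF.S (zq (i - p)) w)))" for w
        using qa by (simp add: x_def)
      have "BM.C $$ (i, j) = cnj (complex_of_real \<kappa> * CF.ip (za j) (zq (i - p)))"
        using qa i Hd Gd by (auto simp: BM.C_def ip_aq scalar_prod_def lessThan_atLeast0 intro!: sum.cong)
      then show ?thesis
        unfolding eq using CF.quant_cross_covariance[OF pos_a pos_q, of j "i - p"] qa i \<kappa>_q[OF i]
        by (simp only: integrable_cnj Bochner_Integration.integral_cnj)
    next
      case qq
      define i' j' where "i' = i - p" and "j' = j - p"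
      have i': "i' < q" and j': "j' < q" using ij qq by (auto simp: i'_def j'_def)
      have C: "BM.C $$ (i, j) = complex_of_real \<alpha> * (if i' = j' then 1 else 0) + complex_of_real \<gamma> * (\<Sum>l<M. G $$ (i', l) * cnj (G $$ (j', l)))"
        using qq i' j' Hd Gd ij unfolding i'_def j'_def
        by (auto simp: BM.C_def scalar_prod_def lessThan_atLeast0 intro!: sum.cong)
      have q: "expectation (\<lambda>w. quant (CF.S (zq i') w) * cnj (quant (CF.S (zq j') w))) = BM.C $$ (i, j)"
      \<comment> \<open>On the diagonal the correlation would be 1, outside the range of
        \<open>quant_covariance\<close>. There the quantized value has modulus 1, and the matrix
        entry is \<open>\<alpha> + \<gamma> * \<rho>q = 1\<close>.\<close>
      proof (cases "i' = j'")
        case True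
        have "\<alpha> + \<gamma> * \<rho>q = 1" using pos by (simp add: \<alpha>_eq \<gamma>_def)
        then have "complex_of_real \<alpha> + complex_of_real \<gamma> * complex_of_real \<rho>q = 1"
          by (metis of_real_1 of_real_add of_real_mult)
        then show ?thesis unfolding C GG[OF i' j'] using True by (simp add: prob_space)
      next
        case False
        have "expectation (\<lambda>w. quant (CF.S (zq i') w) * cnj (quant (CF.S (zq j') w))) =
           complex_of_real (2 / pi * arcsin (if i' mod M = j' mod M then r else 0))"
        proof (rule CF.quant_covariance)
          show "CF.ip (zq i') (zq i') = complex_of_real (\<rho>q + sq2)" "CF.ip (zq j') (zq j') = complex_of_real (\<rho>q + sq2)"
            using ip_qq[OF i' i'] ip_qq[OF j' j'] by simp_all
          have "(if i' mod M = j' mod M then r else 0) * (\<rho>q + sq2) = (if i' mod M = j' mod M then \<rho>q else 0)"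
            using pos by (simp add: r_def)
          then show "CF.ip (zq i') (zq j') = complex_of_real ((if i' mod M = j' mod M then r else 0) * (\<rho>q + sq2))"
            using ip_qq[OF i' j'] False by (simp only:) simp
        qed (use r pos in simp_all)
        also have "\<dots> = BM.C $$ (i, j)"
          unfolding C GG[OF i' j'] using False pos by (simp add: \<gamma>_def)
        finally show ?thesis .
      qed
      show ?thesis using q CF.quant_integrable[of "zq i'" "zq j'"] qq by (simp add: x_def i'_def j'_def)
    qed
    then show "integrable P (\<lambda>w. x i w * cnj (x j w))" "expectation (\<lambda>w. x i w * cnj (x j w)) = BM.C $$ (i, j)" by auto
  qed

  \<comment> \<open>Cross-covariance of parameter and observation\<close>
  let ?X = "row_block (mat_adjoint H) (complex_of_real \<kappa> \<cdot>\<^sub>m mat_adjoint G)"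
  have X_i: "?X $$ (i, j) = (if j < p then cnj (H $$ (j, i)) else complex_of_real \<kappa> * cnj (G $$ (j - p, i)))"
    if "i < M" "j < p + q" for i j
    using that Hd Gd by (subst row_block_index[of _ M p _ q]) (auto intro!: smult_carrier_mat)
  have tx_int: "integrable P (\<lambda>w. th w i * cnj (x j w))" and
    tx_E: "expectation (\<lambda>w. th w i * cnj (x j w)) = ?X $$ (i, j)" if ij: "i < M" "j < p + q" for i j
  proof -
    have "integrable P (\<lambda>w. th w i * cnj (x j w)) \<and> expectation (\<lambda>w. th w i * cnj (x j w)) = ?X $$ (i, j)"
    proof (cases "j < p")
      case True
      then show ?thesis using CF.covariance[OF pos_t pos_a, of i j] ij S_t[OF ij(1)] X_i[OF ij] by (simp add: x_def ip_ta)
    next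
      case False
      then have j: "j - p < q" using ij by auto
      then show ?thesis using CF.quant_cross_covariance[OF pos_t pos_q, of i "j - p"] ij S_t[OF ij(1)] X_i[OF ij] False \<kappa>_q[OF j]
        by (simp add: x_def ip_tq)
    qed
    then show "integrable P (\<lambda>w. th w i * cnj (x j w))" "expectation (\<lambda>w. th w i * cnj (x j w)) = ?X $$ (i, j)" by auto
  qed
  have tt_int: "integrable P (\<lambda>w. th w i * cnj (th w i))" and tt_E: "expectation (\<lambda>w. th w i * cnj (th w i)) = 1" if "i < M" for i
    using CF.covariance[OF pos_t pos_t, of i i] S_t[OF that] that ip_tt[OF that] by simp_all

  \<comment> \<open>Identification of the estimator matrix\<close>
  have CC: "cross_cov P (p + q) (p + q) ?x ?x = BM.C"
    using carrier_matD[OF BM.C_carrier]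
    by (intro eq_matI) (auto simp: cross_cov_def x_i xx_E)
  have CX: "cross_cov P M (p + q) (rvec M th) ?x = ?X"
  proof (rule eq_matI)
    have c: "?X \<in> carrier_mat M (p + q)" using H G by simp
    show "dim_row (cross_cov P M (p + q) (rvec M th) ?x) = dim_row ?X" "dim_col (cross_cov P M (p + q) (rvec M th) ?x) = dim_col ?X"
      using carrier_matD[OF c] by (simp_all add: cross_cov_def)
    fix i j assume "i < dim_row ?X" "j < dim_col ?X"
    then show "cross_cov P M (p + q) (rvec M th) ?x $$ (i, j) = ?X $$ (i, j)"
      using carrier_matD[OF c] tx_E[of i j] by (simp add: cross_cov_def rvec_def x_i)
  qed
  obtain Ci where Ci: "mat_inverse BM.C = Some Ci" "Ci \<in> carrier_mat (p + q) (p + q)" "BM.C * Ci = 1\<^sub>m (p + q)" "Ci * BM.C = 1\<^sub>m (p + q)"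
    using inj_mat_inverse[OF BM.C_carrier BM.C_inj] by blast
  have inv: "invertible_mat BM.C"
    unfolding invertible_mat_def inverts_mat_def square_mat.simps
    using Ci carrier_matD[OF BM.C_carrier] carrier_matD[OF Ci(2)] by metis
  \<comment> \<open>The normal equations identify the cross-covariance with \<open>K * C\<close>, so
    multiplying by the inverse leaves \<open>K\<close>.\<close>
  have XK: "?X * Ci = BM.K"
  proof -
    have "?X * Ci = BM.K * (BM.C * Ci)"
      unfolding BM.K_mult_C[symmetric] by (rule assoc_mult_mat[OF BM.K_carrier BM.C_carrier Ci(2)])
    then show ?thesis using BM.K_carrier by (simp add: Ci)
  qed
  have est: "lmmse P M (p + q) (rvec M th) ?x w = BM.K *\<^sub>v ?x w" for w
    unfolding lmmse_def CC CX Ci(1) option.sel XK ..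

  \<comment> \<open>Closed form of the estimator\<close>
  have ga: "BM.gain_a = complex_of_real (1 / (A + sa2) - \<kappa>\<^sup>2 * B * sa2 / (D * (A + sa2)\<^sup>2))"
    unfolding BM.gain_a_def cD by simp
  have gq: "BM.gain_q = complex_of_real (\<kappa> * sa2 / (D * (A + sa2)))"
    unfolding BM.gain_q_def cD by simp
  have "BM.K *\<^sub>v ?x w = BM.gain_a \<cdot>\<^sub>v (mat_adjoint H *\<^sub>v xa w) + BM.gain_q \<cdot>\<^sub>v (mat_adjoint G *\<^sub>v xq w)" for w
    unfolding vst BM.K_def
    by (subst row_block_mult_vec[of _ M p _ q])
      (simp_all add: xa_c xq_c smult_mat_mult_vec[OF BM.adj_H] smult_mat_mult_vec[OF BM.adj_G])
  moreover have "\<kappa>\<^sup>2 * B * sa2 / (D * (A + sa2)\<^sup>2) =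
     2 * \<rho>q * real nq * sa2 / (pi * (\<rho>q + sq2) * D * (\<rho>a * real na + sa2)^2)"
    by (simp add: \<kappa>2 A_def B_def)
  ultimately have estimator: "lmmse P M (p + q) (rvec M th) ?x w =
     complex_of_real (1 / (\<rho>a * real na + sa2)
                 - 2 * \<rho>q * real nq * sa2 / (pi * (\<rho>q + sq2) * D * (\<rho>a * real na + sa2)^2))
                \<cdot>\<^sub>v (mat_adjoint H *\<^sub>v xa w)
      + complex_of_real (sqrt (2 / (pi * (\<rho>q + sq2))) * sa2 / (D * (\<rho>a * real na + sa2)))
                \<cdot>\<^sub>v (mat_adjoint G *\<^sub>v xq w)" for w
    unfolding est ga gq by (simp only: A_def \<kappa>_def)

  \<comment> \<open>Mean-squared error\<close>
  have est_i: "lmmse P M (p + q) (rvec M th) ?x w $ i = (\<Sum>j<p + q. BM.K $$ (i, j) * x j w)" if "i < M" for i w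
  proof -
    have d: "dim_vec (?x w) = p + q"
      using carrier_vecD[OF xa_c] carrier_vecD[OF xq_c] by (simp add: vst)
    show ?thesis
      unfolding est using that carrier_matD[OF BM.K_carrier] d
      by (auto simp: scalar_prod_def lessThan_atLeast0 x_i intro!: sum.cong)
  qed
  have orth: "(\<Sum>j<p + q. BM.K $$ (i, j) * expectation (\<lambda>w. x j w * cnj (x k w))) = expectation (\<lambda>w. th w i * cnj (x k w))"
    if "i < M" "k < p + q" for i k
  proof -
    have "(\<Sum>j<p + q. BM.K $$ (i, j) * expectation (\<lambda>w. x j w * cnj (x k w))) = (BM.K * BM.C) $$ (i, k)"
      using that carrier_matD[OF BM.K_carrier] carrier_matD[OF BM.C_carrier]
      by (auto simp: scalar_prod_def lessThan_atLeast0 xx_E intro!: sum.cong)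
    then show ?thesis using tx_E[OF that] by (simp add: BM.K_mult_C)
  qed
  \<comment> \<open>The part of the unit variance of one component of the parameter that the
    estimate explains. It is the same for all components, hence the factor \<open>M\<close> in the
    result.\<close>
  define e where "e = A / (A + sa2) + \<kappa>\<^sup>2 * B * sa2\<^sup>2 / (D * (A + sa2)\<^sup>2)"
  have mse_i: "integrable P (\<lambda>w. (cmod (lmmse P M (p + q) (rvec M th) ?x w $ i - th w i))\<^sup>2)"
    "expectation (\<lambda>w. (cmod (lmmse P M (p + q) (rvec M th) ?x w $ i - th w i))\<^sup>2) = 1 - e" if i: "i < M" for i
  proof -
    note mse = linear_estimate_mse[of "p + q" x "\<lambda>w. th w i" "\<lambda>j. BM.K $$ (i, j)", OF xx_int tx_int[OF i] tt_int[OF i] orth[OF i]]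
    show "integrable P (\<lambda>w. (cmod (lmmse P M (p + q) (rvec M th) ?x w $ i - th w i))\<^sup>2)"
      unfolding est_i[OF i] by (rule mse(1))
    have K_i: "BM.K $$ (i, j) = (if j < p then BM.gain_a * cnj (H $$ (j, i)) else BM.gain_q * cnj (G $$ (j - p, i)))" if "j < p + q" for j
      unfolding BM.K_def using that i Hd Gd by (subst row_block_index[of _ M p _ q]) auto
    have hh: "(\<Sum>j<p. cnj (H $$ (j, i)) * H $$ (j, i)) = complex_of_real A"
    proof -
      have "(\<Sum>j<p. cnj (H $$ (j, i)) * H $$ (j, i)) = (mat_adjoint H * H) $$ (i, i)"
        using i Hd by (auto simp: scalar_prod_def lessThan_atLeast0 intro!: sum.cong)
      then show ?thesis unfolding BM.HH using i by simp
    qed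
    have gg: "(\<Sum>j<q. cnj (G $$ (j, i)) * G $$ (j, i)) = complex_of_real B"
    proof -
      have "(\<Sum>j<q. cnj (G $$ (j, i)) * G $$ (j, i)) = (mat_adjoint G * G) $$ (i, i)"
        using i Gd by (auto simp: scalar_prod_def lessThan_atLeast0 intro!: sum.cong)
      then show ?thesis unfolding BM.GG using i by simp
    qed
    have "(\<Sum>j<p + q. BM.K $$ (i, j) * cnj (expectation (\<lambda>w. th w i * cnj (x j w)))) =
       (\<Sum>j<p + q. if j < p then BM.gain_a * (cnj (H $$ (j, i)) * H $$ (j, i))
          else BM.gain_q * complex_of_real \<kappa> * (cnj (G $$ (j - p, i)) * G $$ (j - p, i)))"
      using i by (intro sum.cong refl) (simp add: K_i tx_E X_i)
    also have "\<dots> = (\<Sum>j<p. BM.gain_a * (cnj (H $$ (j, i)) * H $$ (j, i))) +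
        (\<Sum>j<q. BM.gain_q * complex_of_real \<kappa> * (cnj (G $$ (j, i)) * G $$ (j, i)))"
    proof -
      have split: "(\<Sum>j<p + q. f j) = (\<Sum>j<p. f j) + (\<Sum>j<q. f (j + p))" for f :: "nat \<Rightarrow> complex"
        by (induction q) (simp_all add: add.assoc add.commute[of p])
      show ?thesis unfolding split by simp
    qed
    also have "\<dots> = BM.gain_a * complex_of_real A + BM.gain_q * complex_of_real \<kappa> * complex_of_real B"
      unfolding sum_distrib_left[symmetric] hh gg ..
    also have "\<dots> = complex_of_real e"
    proof -
      define t where "t = A + sa2"
      have t: "t > 0" "A = t - sa2" using As by (simp_all add: t_def)
      \<comment> \<open>Both terms carrying \<open>\<kappa>\<^sup>2 * B * sa2\<close> combine
        through \<open>t - A = sa2\<close>; this produces the second factor \<open>sa2\<close>, the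
        fourth power of the noise deviation in the error formula.\<close>
      have e_t: "(1 / t - \<kappa>\<^sup>2 * B * sa2 / (D * t\<^sup>2)) * A + \<kappa> * sa2 / (D * t) * \<kappa> * B = e"
        unfolding e_def t_def[symmetric] unfolding t(2) using t(1) D0
        by (simp add: field_simps power2_eq_square)
      show ?thesis unfolding ga gq t_def[symmetric] e_t[symmetric] by (simp only: of_real_mult of_real_add)
    qed
    finally have "complex_of_real (expectation (\<lambda>w. (cmod ((\<Sum>j<p + q. BM.K $$ (i, j) * x j w) - th w i))\<^sup>2)) = complex_of_real (1 - e)"
      using mse(2) tt_E[OF i] by simp
    then show "expectation (\<lambda>w. (cmod (lmmse P M (p + q) (rvec M th) ?x w $ i - th w i))\<^sup>2) = 1 - e"
      unfolding est_i[OF i] of_real_eq_iff .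
  qed
  have "expectation (\<lambda>w. \<Sum>i<M. (cmod (lmmse P M (p + q) (rvec M th) ?x w $ i - th w i))\<^sup>2) = real M * (1 - e)"
    by (subst Bochner_Integration.integral_sum) (auto simp: mse_i)
  also have "\<dots> = real M - real M * (\<rho>a * real na / (\<rho>a * real na + sa2)
            + 2 * \<rho>q * real nq * sa2^2 / (pi * (\<rho>q + sq2) * D * (\<rho>a * real na + sa2)^2))"
    by (simp add: e_def \<kappa>2 A_def B_def right_diff_distrib)
  finally show ?thesis
    using inv[folded CC] estimator
    unfolding p_def[symmetric] q_def[symmetric] H_def[symmetric] G_def[symmetric] by blast
qed

end
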